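(* Let $\mu,\nu,\lambda$ be partitions with $\mu$ nonempty. If the plethysm coefficient $a^\lambda_{\mu[\nu]}$ is nonzero, then $[\nu]\subseteq[\lambda]$, i.e. $\nu_i\le\lambda_i$ for all $i$.
   Context: $a^\lambda_{\mu[\nu]}=\langle s_\lambda,\ s_\mu\circ s_\nu\rangle$ is the coefficient of $s_\lambda$ in the Schur expansion of the plethysm $s_\mu\circ s_\nu$. For a partition $\lambda$, its diagram is $[\lambda]=\{(j,i)\in\mathbb{N}_0^2:0\le j<\lambda_{i+1}\}$. *)

theory Defs
  imports Main "HOL-Library.Poly_Mapping"
begin

definition is_partition :: "nat list \<Rightarrow> bool" where
  "is_partition xs \<longleftrightarrow> sorted_wrt (\<ge>) xs \<and> (\<forall>x\<in>set xs. 0 < x)"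

definition part :: "nat list \<Rightarrow> nat \<Rightarrow> nat" where
  "part xs i = (if i < length xs then xs ! i else 0)"

text \<open>Young diagram [lambda] = {(j,i). 0 \<le> j < lambda_(i+1)} (column j, row i, 0-indexed).\<close>

definition diagram :: "nat list \<Rightarrow> (nat \<times> nat) set" where
  "diagram lam = {(j, i). j < part lam i}"

definition ssyt :: "nat list \<Rightarrow> nat \<Rightarrow> (nat \<times> nat \<Rightarrow> nat) set" where
  "ssyt lam m = {T. (\<forall>c. c \<notin> diagram lam \<longrightarrow> T c = 0)
     \<and> (\<forall>c\<in>diagram lam. T c < m)
     \<and> (\<forall>j i. (Suc j, i) \<in> diagram lam \<longrightarrow> T (j, i) \<le> T (Suc j, i))
     \<and> (\<forall>j i. (j, Suc i) \<in> diagram lam \<longrightarrow> T (j, i) < T (j, Suc i))}"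

definition schur_at :: "nat list \<Rightarrow> 'a::comm_ring_1 list \<Rightarrow> 'a" where
  "schur_at lam ys = (\<Sum>T\<in>ssyt lam (length ys). \<Prod>c\<in>diagram lam. ys ! T c)"

type_synonym ipoly = "(nat \<Rightarrow>\<^sub>0 nat) \<Rightarrow>\<^sub>0 int"

definition var :: "nat \<Rightarrow> ipoly" where
  "var i = Poly_Mapping.single (Poly_Mapping.single i 1) 1"

definition schur_poly :: "nat \<Rightarrow> nat list \<Rightarrow> ipoly" where
  "schur_poly n lam = schur_at lam (map var [0..<n])"

definition tab_monomial :: "nat list \<Rightarrow> (nat \<times> nat \<Rightarrow> nat) \<Rightarrow> ipoly" where
  "tab_monomial nu T = (\<Prod>c\<in>diagram nu. var (T c))"

text \<open>Plethysm s_mu[s_nu] in n variables: s_mu evaluated at the monomials of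
  s_nu(x_0..x_(n-1)), each listed once per tableau (the order is irrelevant
  since s_mu is symmetric).\<close>

definition plethysm_poly :: "nat \<Rightarrow> nat list \<Rightarrow> nat list \<Rightarrow> ipoly" where
  "plethysm_poly n mu nu =
     schur_at mu (map (tab_monomial nu)
       (SOME ts. distinct ts \<and> set ts = ssyt nu n))"

text \<open>The plethysm coefficient a^lam_{mu[nu]}: coefficient of s_lam in the Schur
  expansion of s_mu \<circ> s_nu. The plethysm is homogeneous of degree d = |mu||nu|;
  working in n = d variables, the Schur polynomials s_kappa with |kappa| = d
  are a basis of the symmetric polynomials of degree d, so the expansion
  is exactly that of symmetric functions.\<close>

definition partitions_of :: "nat \<Rightarrow> nat list set" where
  "partitions_of d = {kap. is_partition kap \<and> sum_list kap = d}"

definition plethysm_coeff :: "nat list \<Rightarrow> nat list \<Rightarrow> nat list \<Rightarrow> int" where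
  "plethysm_coeff lam mu nu =
     (let d = sum_list mu * sum_list nu in
      (THE a. (\<forall>kap. kap \<notin> partitions_of d \<longrightarrow> a kap = 0)
         \<and> plethysm_poly d mu nu = (\<Sum>kap\<in>partitions_of d. of_int (a kap) * schur_poly d kap)) lam)"

end

theory Submission
  imports "Jordan_Normal_Form.Char_Poly" "HOL-Computational_Algebra.Formal_Power_Series" Defs
begin

text \<open>
  Fix a cell \<open>(j, i)\<close> of \<open>nu\<close>, split the variables into \<open>x = (x\<^sub>0, \<dots>)\<close> (the first \<open>i\<close> of
  them) and \<open>z\<close> (the others), and let \<open>K\<close> be the ideal of all \<open>f\<close> such that every monomial of
  \<open>f * V(z)\<close>, \<open>V\<close> the Vandermonde product, has a \<open>z\<close>-exponent of at least \<open>j + |z|\<close>. It contains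
  \<open>h\<^sub>q(z)\<close> for \<open>q > j\<close>, so modulo \<open>K\<close> the generating function \<open>H(t)\<close> of the \<open>h\<^sub>q(z)\<close> is a polynomial
  of degree at most \<open>j\<close>. Taking norms over the \<open>k\<close>-th roots of unity, the same bound holds after
  replacing \<open>z\<close> by \<open>z\<^sup>k\<close>. By the branching rule and Jacobi--Trudi, \<open>K\<close> therefore contains every Schur
  polynomial whose shape contains \<open>(j, i)\<close>, and also \<open>s\<^sub>\<nu>(x\<^sup>k, z\<^sup>k)\<close>, which is the \<open>k\<close>-th power sum
  of the monomials of \<open>s\<^sub>\<nu>\<close>. Newton's identities and Jacobi--Trudi put the plethysm into \<open>K\<close>.
  Conversely, shapes that avoid \<open>(j, i)\<close> cannot contribute: the leading monomial of a combination of
  their Schur polynomials, multiplied by that of \<open>V(z)\<close>, has only small \<open>z\<close>-exponents.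
\<close>

subsection \<open>Removing the largest letter from a tableau\<close>

lemma part_mono:
  assumes "sorted_wrt (\<ge>) lam" "i \<le> i'"
  shows "part lam i' \<le> part lam i"
  using assms by (cases "i = i'") (auto simp: part_def sorted_wrt_iff_nth_less)

lemma part_map: "part (map f [0..<l]) i = (if i < l then f i else 0)"
  by (simp add: part_def)

lemma diagram_eq: "diagram lam = (\<Union>i<length lam. (\<lambda>j. (j, i)) ` {..<part lam i})"
  by (auto simp: diagram_def part_def split: if_splits)

lemma finite_diagram [simp]: "finite (diagram lam)"
  by (simp add: diagram_eq)

lemma prod_diagram: "(\<Prod>c\<in>diagram lam. g c) = (\<Prod>i<length lam. \<Prod>j<part lam i. g (j, i))"
proof -
  have "(\<Prod>c\<in>diagram lam. g c) = (\<Prod>(i, j)\<in>Sigma {..<length lam} (\<lambda>i. {..<part lam i}). g (j, i))"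
    by (rule prod.reindex_bij_witness[of _ "\<lambda>(i, j). (j, i)" "\<lambda>(j, i). (i, j)"])
       (auto simp: diagram_def part_def split: if_splits)
  then show ?thesis
    by (simp add: prod.Sigma)
qed

lemma finite_ssyt [simp]: "finite (ssyt lam m)"
proof (rule finite_subset)
  show "ssyt lam m \<subseteq> {T. \<forall>c. (c \<in> diagram lam \<longrightarrow> T c \<in> {..<m}) \<and> (c \<notin> diagram lam \<longrightarrow> T c = 0)}"
    by (auto simp: ssyt_def)
  show "finite \<dots>"
    by (rule finite_set_of_finite_funs) auto
qed

lemma down_closed_eq_lessThan:
  fixes A :: "nat set"
  assumes "finite A" "\<And>a b. a \<in> A \<Longrightarrow> b < a \<Longrightarrow> b \<in> A"
  shows "A = {..<card A}"
proof (cases "A = {}")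
  case False
  have "A = {..Max A}"
  proof (intro equalityI subsetI)
    fix b assume "b \<in> {..Max A}"
    then show "b \<in> A"
      using assms(2)[of "Max A" b] Max_in[OF assms(1) False] by (auto simp: order_le_less)
  qed (use assms in auto)
  then have "A = {..<Suc (Max A)}" by (simp add: lessThan_Suc_atMost)
  then show ?thesis by (metis card_lessThan)
qed auto

lemma ssyt_row_mono:
  assumes "T \<in> ssyt lam m" "j \<le> j'" "j' < part lam i"
  shows "T (j, i) \<le> T (j', i)"
  using assms(2,3)
proof (induction rule: dec_induct)
  case (step k)
  then have "T (k, i) \<le> T (Suc k, i)"
    using assms(1) by (auto simp: ssyt_def diagram_def)
  with step show ?case by simp
qed simp

text \<open>Rows increase weakly, so the entries below \<open>n\<close> occupy an initial segment of
  the row.\<close>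

lemma ssyt_below_iff:
  assumes "T \<in> ssyt lam m" "j < part lam i"
  shows "T (j, i) < n \<longleftrightarrow> j < card {j. j < part lam i \<and> T (j, i) < n}"
proof -
  let ?A = "{j. j < part lam i \<and> T (j, i) < n}"
  have "?A = {..<card ?A}"
  proof (rule down_closed_eq_lessThan)
    fix a b assume "a \<in> ?A" "b < a"
    then show "b \<in> ?A"
      using ssyt_row_mono[OF assms(1), of b a i] by auto
  qed auto
  then show ?thesis using assms(2) by auto
qed

text \<open>Deleting the cells that carry the largest letter removes a horizontal strip; \<open>f i\<close> is the
  length of the remaining part of row \<open>i\<close>.\<close>

lemma schur_at_branch:
  fixes y :: "'a::comm_ring_1"
  assumes srt: "sorted_wrt (\<ge>) lam"
  shows "schur_at lam (ys @ [y]) =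
    (\<Sum>f\<in>PiE {0..<length lam} (\<lambda>i. {part lam (Suc i)..part lam i}).
      (\<Prod>i<length lam. y ^ (part lam i - f i)) * schur_at (map f [0..<length lam]) ys)"
proof -
  define l where "l = length lam"
  define n where "n = length ys"
  define F where "F = PiE {0..<l} (\<lambda>i. {part lam (Suc i)..part lam i})"
  define D where "D f = diagram (map f [0..<l])" for f
  \<comment> \<open>\<open>ext\<close> fills the strip outside \<open>D f\<close> with the largest
    letter \<open>n\<close>. Its inverse \<open>cut\<close> records the row lengths of the part
    below \<open>n\<close> and puts 0, the value that \<open>ssyt\<close> prescribes off the
    diagram, into the deleted cells. \<open>restrict\<close> makes these lengths extensional, as
    \<open>PiE\<close> demands.\<close>
  define ext where "ext = (\<lambda>(f, T) c. if c \<in> diagram lam - D f then n else T c)"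
  define sh where "sh T = restrict (\<lambda>i. card {j. j < part lam i \<and> T (j, i) < n}) {0..<l}" for T :: "nat \<times> nat \<Rightarrow> nat"
  define cut where "cut T = (sh T, \<lambda>c. if T c < n then T c else 0)" for T
  have lam0: "part lam i = 0" if "i \<ge> l" for i using that by (simp add: part_def l_def)
  have D_iff: "(j, i) \<in> D f \<longleftrightarrow> i < l \<and> j < f i" for i j f
    by (auto simp: D_def diagram_def part_map)
  have lam_iff: "(j, i) \<in> diagram lam \<longleftrightarrow> j < part lam i" for i j
    by (simp add: diagram_def)
  have F_bd: "part lam (Suc i) \<le> f i \<and> f i \<le> part lam i" if "f \<in> F" "i < l" for f i
    using that by (auto simp: F_def PiE_iff)
  have D_sub: "D f \<subseteq> diagram lam" if "f \<in> F" for f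
    using F_bd[OF that] by (force simp: D_iff lam_iff dest: order_less_le_trans)
  have below: "T (j, i) < n \<longleftrightarrow> j < sh T i" if "T \<in> ssyt lam (Suc n)" "j < part lam i" for T i j
    using ssyt_below_iff[OF that] lam0[of i] that(2) by (cases "i < l") (auto simp: sh_def)
  have sh_le: "sh T i \<le> part lam i" if "i < l" for T i
  proof -
    have "card {j. j < part lam i \<and> T (j, i) < n} \<le> card {..<part lam i}"
      by (rule card_mono) auto
    then show ?thesis using that by (simp add: sh_def)
  qed
  have sh_F: "sh T \<in> F" if T: "T \<in> ssyt lam (Suc n)" for T
    unfolding F_def
  proof (rule PiE_I)
    fix i assume i: "i \<in> {0..<l}"
    \<comment> \<open>Interlacing comes from column strictness: above a cell of row
      \<open>Suc i\<close> there is an entry smaller than one that is at most \<open>n\<close>, so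
      this entry survives the deletion.\<close>
    have "part lam (Suc i) \<le> sh T i"
    proof (rule ccontr)
      assume a: "\<not> part lam (Suc i) \<le> sh T i"
      define j where "j = sh T i"
      have j: "j < part lam (Suc i)" using a by (simp add: j_def)
      moreover have j': "j < part lam i" using j part_mono[OF srt, of i "Suc i"] by simp
      ultimately have "T (j, i) < T (j, Suc i)" "T (j, Suc i) < Suc n"
        using T by (auto simp: ssyt_def diagram_def)
      then have "T (j, i) < n" by simp
      then show False using below[OF T j'] by (simp add: j_def)
    qed
    then show "sh T i \<in> {part lam (Suc i)..part lam i}" using sh_le i by auto
  qed (simp add: sh_def)
  have D_sh: "(j, i) \<in> D (sh T) \<longleftrightarrow> (j, i) \<in> diagram lam \<and> T (j, i) < n"
    if T: "T \<in> ssyt lam (Suc n)" for T j i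
    using below[OF T, of j i] lam0[of i] sh_le[of i T]
    by (cases "i < l") (auto simp: D_iff lam_iff)
  have "schur_at lam (ys @ [y]) = (\<Sum>T\<in>ssyt lam (Suc n). \<Prod>c\<in>diagram lam. (ys @ [y]) ! T c)"
    by (simp add: schur_at_def n_def)
  also have "\<dots> = (\<Sum>(f, T)\<in>Sigma F (\<lambda>f. ssyt (map f [0..<l]) n).
      (\<Prod>i<l. y ^ (part lam i - f i)) * (\<Prod>c\<in>D f. ys ! T c))"
  proof (rule sum.reindex_bij_witness[of _ ext cut])
    fix T assume T: "T \<in> ssyt lam (Suc n)"
    have T0: "T c = 0" if "c \<notin> diagram lam" for c using T that unfolding ssyt_def by blast
    have Tn: "T c \<le> n" if "c \<in> diagram lam" for c using T that unfolding ssyt_def by (simp add: less_Suc_eq_le)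
    show "ext (cut T) = T"
    proof
      fix c :: "nat \<times> nat"
      obtain j i where c: "c = (j, i)" by (cases c)
      show "ext (cut T) c = T c"
        using T0[of c] Tn[of c] D_sh[OF T, of j i] by (auto simp: ext_def cut_def c)
    qed
    show "cut T \<in> Sigma F (\<lambda>f. ssyt (map f [0..<l]) n)"
    proof -
      have "(\<lambda>c. if T c < n then T c else 0) \<in> ssyt (map (sh T) [0..<l]) n"
        unfolding ssyt_def D_def[symmetric]
      proof (intro CollectI conjI allI impI ballI)
        fix c assume "c \<notin> D (sh T)"
        then show "(if T c < n then T c else 0) = 0"
          using T0[of c] D_sh[OF T, of "fst c" "snd c"] by auto
      next
        fix c assume "c \<in> D (sh T)"
        then show "(if T c < n then T c else 0) < n"
          using D_sh[OF T, of "fst c" "snd c"] by auto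
      next
        fix j i assume "(Suc j, i) \<in> D (sh T)"
        then show "(if T (j, i) < n then T (j, i) else 0) \<le> (if T (Suc j, i) < n then T (Suc j, i) else 0)"
          using D_sh[OF T, of "Suc j" "i"] T by (auto simp: ssyt_def)
      next
        fix j i assume "(j, Suc i) \<in> D (sh T)"
        then have *: "(j, Suc i) \<in> diagram lam" "T (j, Suc i) < n"
          using D_sh[OF T, of j "Suc i"] by auto
        then have "T (j, i) < T (j, Suc i)" using T by (auto simp: ssyt_def)
        then show "(if T (j, i) < n then T (j, i) else 0) < (if T (j, Suc i) < n then T (j, Suc i) else 0)"
          using * by auto
      qed
      then show ?thesis using sh_F[OF T] by (simp add: cut_def)
    qed
    have "(\<Prod>c\<in>diagram lam. (ys @ [y]) ! T c) =
        (\<Prod>i<l. \<Prod>j<part lam i. (ys @ [y]) ! T (j, i))"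
      by (simp add: prod_diagram l_def)
    also have "\<dots> = (\<Prod>i<l. y ^ (part lam i - sh T i) * (\<Prod>j<sh T i. ys ! T (j, i)))"
    proof (rule prod.cong[OF refl])
      fix i assume i: "i \<in> {..<l}"
      have "(\<Prod>j<part lam i. (ys @ [y]) ! T (j, i)) =
          (\<Prod>j<sh T i. (ys @ [y]) ! T (j, i)) * (\<Prod>j\<in>{sh T i..<part lam i}. (ys @ [y]) ! T (j, i))"
        using sh_le[of i T] i
        by (subst prod.union_disjoint[symmetric]) (auto intro!: prod.cong)
      also have "(\<Prod>j<sh T i. (ys @ [y]) ! T (j, i)) = (\<Prod>j<sh T i. ys ! T (j, i))"
        using sh_le[of i T] i below[OF T, of _ i]
        by (intro prod.cong) (auto simp: nth_append n_def)
      also have "(\<Prod>j\<in>{sh T i..<part lam i}. (ys @ [y]) ! T (j, i)) = (\<Prod>j\<in>{sh T i..<part lam i}. y)"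
      proof (intro prod.cong refl)
        fix j assume j: "j \<in> {sh T i..<part lam i}"
        then have "T (j, i) = n"
          using below[OF T, of j i] Tn[of "(j, i)"] by (auto simp: lam_iff)
        then show "(ys @ [y]) ! T (j, i) = y" by (simp add: n_def)
      qed
      finally show "(\<Prod>j<part lam i. (ys @ [y]) ! T (j, i)) = y ^ (part lam i - sh T i) * (\<Prod>j<sh T i. ys ! T (j, i))"
        by simp
    qed
    also have "\<dots> = (\<Prod>i<l. y ^ (part lam i - sh T i)) * (\<Prod>c\<in>D (sh T). ys ! T c)"
      by (simp add: D_def prod_diagram part_map prod.distrib)
    also have "(\<Prod>c\<in>D (sh T). ys ! T c) = (\<Prod>c\<in>D (sh T). ys ! (if T c < n then T c else 0))"
      using D_sh[OF T] by (intro prod.cong) auto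
    finally show "(case cut T of (f, T) \<Rightarrow> (\<Prod>i<l. y ^ (part lam i - f i)) * (\<Prod>c\<in>D f. ys ! T c)) =
        (\<Prod>c\<in>diagram lam. (ys @ [y]) ! T c)"
      by (simp add: cut_def)
  next
    fix p assume "p \<in> Sigma F (\<lambda>f. ssyt (map f [0..<l]) n)"
    then obtain f T where p: "p = (f, T)" and f: "f \<in> F" and T: "T \<in> ssyt (map f [0..<l]) n"
      by auto
    have T0: "T c = 0" if "c \<notin> D f" for c using T that unfolding ssyt_def D_def by blast
    have Tn: "T c < n" if "c \<in> D f" for c using T that unfolding ssyt_def D_def by blast
    have Trow: "T (j, i) \<le> T (Suc j, i)" if "(Suc j, i) \<in> D f" for j i
      using T that unfolding ssyt_def D_def by blast
    have Tcol: "T (j, i) < T (j, Suc i)" if "(j, Suc i) \<in> D f" for j i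
      using T that unfolding ssyt_def D_def by blast
    define E where "E = ext p"
    have E: "E c = (if c \<in> diagram lam - D f then n else T c)" for c
      by (simp add: E_def ext_def p)
    have E_less: "E c < n \<longleftrightarrow> c \<in> D f" if "c \<in> diagram lam" for c
      using that Tn[of c] by (auto simp: E)
    show "ext p \<in> ssyt lam (Suc n)"
      unfolding E_def[symmetric] ssyt_def
    proof (intro CollectI conjI allI impI ballI)
      fix c assume "c \<notin> diagram lam"
      then show "E c = 0" using T0[of c] D_sub[OF f] by (auto simp: E)
    next
      fix c assume "c \<in> diagram lam"
      then show "E c < Suc n" using Tn[of c] by (auto simp: E)
    next
      fix j i assume "(Suc j, i) \<in> diagram lam"
      then show "E (j, i) \<le> E (Suc j, i)"
        using Tn[of "(j, i)"] Trow[of j i] by (auto simp: E lam_iff D_iff)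
    next
      fix j i assume a: "(j, Suc i) \<in> diagram lam"
      then have "Suc i < l" using lam0[of "Suc i"] by (auto simp: lam_iff not_less[symmetric])
      \<comment> \<open>The bound \<open>part lam (Suc i) <= f i\<close> keeps two strip cells out
        of one column: the cell above carries a letter below \<open>n\<close>.\<close>
      moreover have "j < f i"
        using a F_bd[OF f, of i] \<open>Suc i < l\<close> by (auto simp: lam_iff)
      ultimately show "E (j, i) < E (j, Suc i)"
        using a Tn[of "(j, i)"] Tcol[of j i] by (auto simp: E lam_iff D_iff)
    qed
    have "sh E i = f i" if i: "i < l" for i
    proof -
      have "{j. j < part lam i \<and> E (j, i) < n} = {..<f i}"
        using E_less[of "(_, i)"] F_bd[OF f i] i by (auto simp: lam_iff D_iff)
      then show ?thesis using i by (simp add: sh_def)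
    qed
    then have "sh E = f"
      using f by (auto simp: F_def PiE_iff extensional_def fun_eq_iff sh_def)
    moreover have "(\<lambda>c. if E c < n then E c else 0) = T"
      using T0 Tn D_sub[OF f] by (auto simp: E fun_eq_iff)
    ultimately have "cut E = p"
      by (simp add: cut_def p)
    then show "cut (ext p) = p"
      by (simp add: E_def)
  qed
  also have "\<dots> = (\<Sum>f\<in>F. \<Sum>T\<in>ssyt (map f [0..<l]) n. (\<Prod>i<l. y ^ (part lam i - f i)) * (\<Prod>c\<in>D f. ys ! T c))"
    by (rule sum.Sigma[symmetric]) (auto simp: F_def intro: finite_PiE)
  also have "\<dots> = (\<Sum>f\<in>F. (\<Prod>i<l. y ^ (part lam i - f i)) * schur_at (map f [0..<l]) ys)"
    by (simp add: schur_at_def D_def n_def sum_distrib_left)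
  finally show ?thesis by (simp add: F_def l_def)
qed

subsection \<open>The Jacobi--Trudi identity\<close>

unbundle fps_syntax
no_notation vec_index (infixl "$" 100)

section \<open>Generating functions of complete homogeneous polynomials\<close>

definition geom :: "'a::comm_ring_1 \<Rightarrow> 'a fps" where
  "geom y = Abs_fps (\<lambda>n. y ^ n)"

definition complete_gf :: "'a::comm_ring_1 list \<Rightarrow> 'a fps" where
  "complete_gf ys = prod_list (map geom ys)"

text \<open>The index is an integer because Jacobi--Trudi entries below the diagonal can have
  negative index; they are 0 there.\<close>

definition complete_at :: "'a::comm_ring_1 list \<Rightarrow> int \<Rightarrow> 'a" where
  "complete_at ys k = (if k < 0 then 0 else complete_gf ys $ nat k)"

lemma geom_eq: "geom y = 1 + fps_const y * fps_X * geom y"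
proof (rule fps_ext)
  fix n show "geom y $ n = (1 + fps_const y * fps_X * geom y) $ n"
    by (cases n) (simp_all add: geom_def mult.assoc)
qed

lemma geom_inverse: "(1 - fps_const y * fps_X) * geom y = 1"
  using geom_eq[of y] by (simp add: algebra_simps)

lemma complete_gf_simps [simp]:
  "complete_gf [] = 1"
  "complete_gf (y # ys) = geom y * complete_gf ys"
  "complete_gf (ys @ zs) = complete_gf ys * complete_gf zs"
  by (simp_all add: complete_gf_def)

lemma complete_gf_mset: "mset ys = mset zs \<Longrightarrow> complete_gf ys = complete_gf zs"
  unfolding complete_gf_def by (metis mset_map prod_mset_prod_list)

lemma complete_gf_snoc_recursion:
  "complete_gf (ys @ [y]) = complete_gf ys + fps_const y * fps_X * complete_gf (ys @ [y])"
  by (subst complete_gf_simps(3), subst complete_gf_simps(2), subst geom_eq)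
     (simp add: algebra_simps)

lemma complete_at_neg: "k < 0 \<Longrightarrow> complete_at ys k = 0"
  by (simp add: complete_at_def)

lemma complete_at_snoc:
  "complete_at (ys @ [y]) k = complete_at ys k + y * complete_at (ys @ [y]) (k - 1)"
proof (cases "k \<ge> 0")
  case True
  then obtain n where n: "k = int n" using nonneg_int_cases by blast
  have "complete_gf (ys @ [y]) $ n = complete_gf ys $ n + (fps_const y * fps_X * complete_gf (ys @ [y])) $ n"
    by (subst complete_gf_snoc_recursion) simp
  then show ?thesis
    by (cases n) (simp_all add: n complete_at_def mult.assoc nat_add_distrib del: complete_gf_simps)
qed (simp add: complete_at_def)

text \<open>The recursion in \<open>complete_at_snoc\<close> telescopes. The left side is what a row
  operation makes of two neighbouring rows of the Jacobi--Trudi matrix in \<open>ys @ [y]\<close>;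
  the right side involves complete polynomials in \<open>ys\<close> alone.\<close>

lemma complete_at_snoc_iterate:
  "complete_at (ys @ [y]) k - y ^ p * complete_at (ys @ [y]) (k - int p) =
    (\<Sum>a<p. y ^ a * complete_at ys (k - int a))"
proof (induction p)
  case (Suc p)
  have "complete_at (ys @ [y]) (k - int p) = complete_at ys (k - int p) + y * complete_at (ys @ [y]) (k - int (Suc p))"
    using complete_at_snoc[of ys y "k - int p"] by (simp add: algebra_simps)
  then show ?case
    using Suc by (simp add: algebra_simps)
qed simp

definition jacobi_trudi :: "nat list \<Rightarrow> 'a::comm_ring_1 list \<Rightarrow> 'a" where
  "jacobi_trudi lam ys = det (mat (length lam) (length lam)
    (\<lambda>(i, j). complete_at ys (int (part lam i) - int i + int j)))"

lemma jacobi_trudi_sum: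
  "jacobi_trudi lam ys = (\<Sum>p | p permutes {0..<length lam}. signof p *
    (\<Prod>i = 0..<length lam. complete_at ys (int (part lam i) - int i + int (p i))))"
  unfolding jacobi_trudi_def
  by (subst det_def'[where n = "length lam"]) (auto intro!: sum.cong prod.cong simp: permutes_def)

text \<open>Mirrors \<open>schur_at_branch\<close>. Subtracting from each row a power of
  \<open>y\<close> times the next one preserves the determinant and turns each entry into a sum over
  the admissible new lengths of that row; expanding the products of these sums gives the sum over
  all \<open>f\<close>.\<close>

lemma jacobi_trudi_branch:
  fixes y :: "'a::comm_ring_1"
  assumes srt: "sorted_wrt (\<ge>) lam"
  shows "jacobi_trudi lam (ys @ [y]) =
    (\<Sum>f\<in>PiE {0..<length lam} (\<lambda>i. {part lam (Suc i)..part lam i}).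
      (\<Prod>i<length lam. y ^ (part lam i - f i)) * jacobi_trudi (map f [0..<length lam]) ys)"
proof -
  define l where "l = length lam"
  define b where "b i = int (part lam i) - int i" for i
  define A where "A = mat l l (\<lambda>(i, j). complete_at (ys @ [y]) (b i + int j))"
  \<comment> \<open>The offsets \<open>b i\<close> and \<open>b (Suc i)\<close> differ by
    \<open>q i + 1\<close>, which fixes the power of \<open>y\<close> in the unitriangular matrix
    \<open>U\<close> that performs the row operation.\<close>
  define q where "q i = part lam i - part lam (Suc i)" for i
  define U where "U = mat l l (\<lambda>(i, k). if k = i then 1 else if k = Suc i then - (y ^ Suc (q i)) else 0)"
  define P where "P = {p. p permutes {0..<l}}"
  have carr: "A \<in> carrier_mat l l" "U \<in> carrier_mat l l"
    by (simp_all add: A_def U_def)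
  have row: "(\<Sum>a\<le>q i. y ^ a * complete_at ys (b i + int j - int a)) =
        (\<Sum>k\<in>{part lam (Suc i)..part lam i}. y ^ (part lam i - k) * complete_at ys (int k - int i + int j))" for i j
    using part_mono[OF srt, of i "Suc i"]
    by (intro sum.reindex_bij_witness[of _ "\<lambda>k. part lam i - k" "\<lambda>a. part lam i - a"])
       (auto simp: q_def b_def of_nat_diff algebra_simps intro!: arg_cong[where f = "complete_at ys"])
  have "det U = prod_list (diag_mat U)"
    by (rule det_upper_triangular[OF _ carr(2)]) (auto simp: U_def upper_triangular_def)
  also have "\<dots> = 1"
    by (simp add: prod_list_diag_prod U_def)
  finally have "det A = det (U * A)"
    by (simp add: det_mult[OF carr(2,1)])
  also have "U * A = mat l l (\<lambda>(i, j). \<Sum>a\<le>q i. y ^ a * complete_at ys (b i + int j - int a))"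
  proof (rule eq_matI)
    fix i j assume "i < dim_row (mat l l (\<lambda>(i, j). \<Sum>a\<le>q i. y ^ a * complete_at ys (b i + int j - int a)))"
      "j < dim_col (mat l l (\<lambda>(i, j). \<Sum>a\<le>q i. y ^ a * complete_at ys (b i + int j - int a)))"
    then have ij: "i < l" "j < l" by auto
    have bi: "b (Suc i) = b i - int (Suc (q i))"
      using part_mono[OF srt, of i "Suc i"] by (simp add: b_def q_def)
    have "(U * A) $$ (i, j) = (\<Sum>k<l. U $$ (i, k) * A $$ (k, j))"
      using ij carr by (simp add: scalar_prod_def lessThan_atLeast0)
    also have "\<dots> = (\<Sum>k<l. (if k = i then A $$ (i, j) else 0) + (if k = Suc i then - (y ^ Suc (q i)) * A $$ (Suc i, j) else 0))"
      using ij by (intro sum.cong) (auto simp: U_def)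
    also have "\<dots> = A $$ (i, j) + (if Suc i < l then - (y ^ Suc (q i)) * A $$ (Suc i, j) else 0)"
      using ij by (simp add: sum.distrib)
    also have "\<dots> = complete_at (ys @ [y]) (b i + int j) - y ^ Suc (q i) * complete_at (ys @ [y]) (b (Suc i) + int j)"
    proof (cases "Suc i < l")
      case False
      \<comment> \<open>The row after the last would have entries of index
        \<open>int j - int l < 0\<close>, all zero, so the last row obeys the same formula.\<close>
      then have "b (Suc i) + int j < 0"
        using ij by (simp add: b_def part_def l_def)
      then show ?thesis using False ij by (simp add: A_def complete_at_neg)
    qed (use ij in \<open>simp add: A_def\<close>)
    also have "\<dots> = (\<Sum>a<Suc (q i). y ^ a * complete_at ys (b i + int j - int a))"
      unfolding complete_at_snoc_iterate[symmetric] bi by (simp add: algebra_simps)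
    finally show "(U * A) $$ (i, j) = mat l l (\<lambda>(i, j). \<Sum>a\<le>q i. y ^ a * complete_at ys (b i + int j - int a)) $$ (i, j)"
      using ij by (simp only: lessThan_Suc_atMost) simp
  qed (use carr in auto)
  also have "det \<dots> = (\<Sum>p\<in>P. signof p * (\<Prod>i = 0..<l. \<Sum>a\<le>q i. y ^ a * complete_at ys (b i + int (p i) - int a)))"
    unfolding P_def
    by (subst det_def'[where n = l]) (auto intro!: sum.cong prod.cong simp: permutes_def)
  also have "\<dots> = (\<Sum>p\<in>P. signof p * (\<Prod>i = 0..<l. \<Sum>k\<in>{part lam (Suc i)..part lam i}.
      y ^ (part lam i - k) * complete_at ys (int k - int i + int (p i))))"
    by (simp add: row)
  also have "\<dots> = (\<Sum>p\<in>P. \<Sum>f\<in>PiE {0..<l} (\<lambda>i. {part lam (Suc i)..part lam i}). signof p * (\<Prod>i = 0..<l.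
      y ^ (part lam i - f i) * complete_at ys (int (f i) - int i + int (p i))))"
    by (subst prod_sum_PiE) (auto simp: sum_distrib_left)
  also have "\<dots> = (\<Sum>f\<in>PiE {0..<l} (\<lambda>i. {part lam (Suc i)..part lam i}). \<Sum>p\<in>P. signof p * (\<Prod>i = 0..<l.
      y ^ (part lam i - f i) * complete_at ys (int (f i) - int i + int (p i))))"
    by (rule sum.swap)
  also have "\<dots> = (\<Sum>f\<in>PiE {0..<l} (\<lambda>i. {part lam (Suc i)..part lam i}).
      (\<Prod>i<l. y ^ (part lam i - f i)) * jacobi_trudi (map f [0..<l]) ys)"
    unfolding jacobi_trudi_sum
    by (intro sum.cong) (auto simp: sum_distrib_left prod.distrib part_map P_def lessThan_atLeast0 mult_ac intro!: sum.cong prod.cong)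
  finally show ?thesis
    by (simp add: jacobi_trudi_def A_def l_def b_def)
qed

lemma schur_at_Nil: "schur_at lam [] = (if diagram lam = {} then 1 else 0)"
proof -
  have "ssyt lam 0 = (if diagram lam = {} then {\<lambda>_. 0} else {})"
    by (auto simp: ssyt_def)
  then show ?thesis by (simp add: schur_at_def)
qed

lemma jacobi_trudi_Nil:
  assumes srt: "sorted_wrt (\<ge>) lam"
  shows "jacobi_trudi lam [] = (if diagram lam = {} then 1 else 0 :: 'a::comm_ring_1)"
proof (cases "diagram lam = {}")
  case True
  then have "part lam i = 0" for i
    by (auto simp: diagram_def)
  then have "jacobi_trudi lam [] = det (mat (length lam) (length lam) (\<lambda>(i, j). complete_at ([] :: 'a list) (int j - int i)))"
    by (simp add: jacobi_trudi_def)
  also have "mat (length lam) (length lam) (\<lambda>(i, j). complete_at ([] :: 'a list) (int j - int i)) = 1\<^sub>m (length lam)"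
    by (intro eq_matI) (auto simp: complete_at_def)
  finally show ?thesis using True by simp
next
  case False
  then obtain j i where "j < part lam i" by (auto simp: diagram_def)
  then have i: "part lam i > 0" by simp
  have l: "length lam > 0" using i by (auto simp: part_def split: if_splits)
  have p0: "part lam 0 > 0" using i part_mono[OF srt, of 0 i] by simp
  \<comment> \<open>The first row has positive indices only, so in the empty alphabet all its
    entries vanish.\<close>
  have "(\<Prod>i = 0..<length lam. complete_at ([] :: 'a list) (int (part lam i) - int i + int (p i))) = 0" for p
    using l p0 by (intro prod_zero bexI[of _ 0]) (auto simp: complete_at_def)
  then show ?thesis using False by (simp add: jacobi_trudi_sum)
qed

lemma sorted_interlacing:
  assumes "sorted_wrt (\<ge>) lam" "f \<in> PiE {0..<length lam} (\<lambda>i. {part lam (Suc i)..part lam i})"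
  shows "sorted_wrt (\<ge>) (map f [0..<length lam])"
proof (clarsimp simp: sorted_wrt_iff_nth_less)
  fix i j assume ij: "i < j" "j < length lam"
  then have "f j \<le> part lam j" "part lam (Suc i) \<le> f i" using assms(2) by (auto simp: PiE_iff)
  with part_mono[OF assms(1), of "Suc i" j] ij show "f j \<le> f i" by simp
qed

text \<open>Both sides satisfy the same branching recursion in the last variable and agree when
  there are no variables. Weakly decreasing lists are the right generality, since the shapes
  \<open>map f [0..<length lam]\<close> may end in zero rows.\<close>

theorem jacobi_trudi_identity:
  "sorted_wrt (\<ge>) lam \<Longrightarrow> schur_at lam ys = jacobi_trudi lam ys"
proof (induction ys arbitrary: lam rule: rev_induct)
  case Nil
  then show ?case by (simp add: schur_at_Nil jacobi_trudi_Nil)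
next
  case (snoc y ys)
  then show ?case
    by (simp add: schur_at_branch jacobi_trudi_branch sorted_interlacing)
qed

text \<open>By Jacobi--Trudi, a Schur polynomial sees its arguments only through their
  \<open>complete_gf\<close>. All symmetry statements below rest on this.\<close>

lemma schur_at_cong_complete_gf:
  assumes "sorted_wrt (\<ge>) lam" "complete_gf ys = complete_gf zs"
  shows "schur_at lam ys = schur_at lam zs"
proof -
  have "complete_at ys = complete_at zs"
    by (rule ext) (simp add: complete_at_def assms(2))
  then show ?thesis
    by (simp add: jacobi_trudi_identity[OF assms(1)] jacobi_trudi_def)
qed

lemma schur_at_mset:
  assumes "sorted_wrt (\<ge>) lam" "mset ys = mset zs"
  shows "schur_at lam ys = schur_at lam zs"
  using assms by (intro schur_at_cong_complete_gf complete_gf_mset)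

subsection \<open>Ideals containing the high complete homogeneous polynomials\<close>

locale ring_ideal =
  fixes K :: "'a::comm_ring_1 set"
  assumes zero_mem: "0 \<in> K"
    and add_mem: "f \<in> K \<Longrightarrow> g \<in> K \<Longrightarrow> f + g \<in> K"
    and mult_mem: "f \<in> K \<Longrightarrow> g * f \<in> K"
begin

lemma mult_mem': "f \<in> K \<Longrightarrow> f * g \<in> K"
  using mult_mem[of f g] by (simp add: mult.commute)

lemma sum_mem: "(\<And>a. a \<in> A \<Longrightarrow> F a \<in> K) \<Longrightarrow> sum F A \<in> K"
  by (induction A rule: infinite_finite_induct) (auto simp: zero_mem add_mem)

text \<open>Each Leibniz term contains an entry of the first row, whose indices are all at least
  \<open>part lam 0\<close>.\<close>

lemma schur_at_mem_first_row:
  assumes "sorted_wrt (\<ge>) lam" "lam \<noteq> []" "c \<le> part lam 0"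
    and mem: "\<And>n. c \<le> n \<Longrightarrow> complete_gf ys $ n \<in> K"
  shows "schur_at lam ys \<in> K"
  unfolding jacobi_trudi_identity[OF assms(1)] jacobi_trudi_sum
proof (intro sum_mem mult_mem)
  fix p :: "nat \<Rightarrow> nat"
  have "{0..<length lam} = insert 0 {Suc 0..<length lam}"
    using assms(2) by (auto simp: Suc_le_eq)
  moreover have "complete_at ys (int (part lam 0) + int (p 0)) \<in> K"
    using assms(3) mem[of "part lam 0 + p 0"] by (simp add: complete_at_def nat_add_distrib)
  ultimately show "(\<Prod>i = 0..<length lam. complete_at ys (int (part lam i) - int i + int (p i))) \<in> K"
    by (simp add: mult_mem')
qed

text \<open>Each letter of \<open>xs\<close> takes away a horizontal strip, and interlacing gives
  \<open>part lam (Suc i) <= f i\<close>. So the length bound \<open>c\<close> passes up by one row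
  with each letter and reaches the first row when only \<open>zs\<close> is left.\<close>

lemma schur_at_mem_append:
  assumes "sorted_wrt (\<ge>) lam" "c \<le> part lam (length xs)" "0 < c"
    and mem: "\<And>n. c \<le> n \<Longrightarrow> complete_gf zs $ n \<in> K"
  shows "schur_at lam (zs @ xs) \<in> K"
  using assms(1,2)
proof (induction xs arbitrary: lam rule: rev_induct)
  case Nil
  then have "lam \<noteq> []" using assms(3) by (auto simp: part_def)
  then show ?case using Nil schur_at_mem_first_row[OF _ _ _ mem] by simp
next
  case (snoc x xs)
  let ?i = "length xs"
  have "(\<Prod>i<length lam. x ^ (part lam i - f i)) * schur_at (map f [0..<length lam]) (zs @ xs) \<in> K"
    if f: "f \<in> PiE {0..<length lam} (\<lambda>i. {part lam (Suc i)..part lam i})" for f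
  proof (intro mult_mem snoc.IH)
    show "sorted_wrt (\<ge>) (map f [0..<length lam])"
      by (rule sorted_interlacing[OF snoc.prems(1) f])
    \<comment> \<open>Because \<open>0 < c\<close>, row \<open>Suc ?i\<close> is a row of
      \<open>lam\<close>, so \<open>?i\<close> lies in the range where \<open>f\<close> is
      constrained.\<close>
    have "Suc ?i < length lam"
      using snoc.prems(2) assms(3) by (auto simp: part_def split: if_splits)
    then show "c \<le> part (map f [0..<length lam]) ?i"
      using snoc.prems(2) PiE_mem[OF f, of ?i] by (simp add: part_map)
  qed
  then show ?case
    unfolding append_assoc[symmetric] schur_at_branch[OF snoc.prems(1)] by (rule sum_mem)
qed

text \<open>Modulo \<open>K\<close> the factors are polynomials of degree at most \<open>b\<close>
  and \<open>b'\<close>, and degrees add.\<close>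

lemma fps_mult_nth_mem:
  assumes "\<And>n. b < n \<Longrightarrow> F $ n \<in> K" "\<And>n. b' < n \<Longrightarrow> G $ n \<in> K" "b + b' < n"
  shows "(F * G) $ n \<in> K"
  unfolding fps_mult_nth
proof (rule sum_mem)
  fix i assume "i \<in> {0..n}"
  with assms(3) have "b < i \<or> b' < n - i" by auto
  then show "F $ i * G $ (n - i) \<in> K"
    using assms(1,2) mult_mem mult_mem' by blast
qed

lemma fps_prod_nth_mem:
  assumes "finite R" "\<And>r n. r \<in> R \<Longrightarrow> b < n \<Longrightarrow> F r $ n \<in> K" "card R * b < n"
  shows "(\<Prod>r\<in>R. F r) $ n \<in> K"
  using assms
proof (induction R arbitrary: n rule: finite_induct)
  case empty
  then show ?case by (simp add: zero_mem)
next
  case (insert r R)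
  show ?case
    unfolding prod.insert[OF insert.hyps(1,2)]
    by (rule fps_mult_nth_mem[of b _ "card R * b"]) (use insert in auto)
qed

end

section \<open>Norms over the roots of unity\<close>

lemma prod_roots_unity_poly:
  assumes "k > 0"
  shows "(\<Prod>w | w ^ k = 1. [:1, - w:]) = 1 - monom (1::complex) k"
proof (rule poly_eqI_degree)
  let ?R = "{w::complex. w ^ k = 1}"
  have R: "finite ?R" "card ?R = k"
    using assms by (auto simp: finite_roots_unity card_roots_unity_eq)
  \<comment> \<open>Agreement at 0 and at the \<open>k\<close> roots of unity suffices for two
    polynomials of degree at most \<open>k\<close>.\<close>
  then have card: "card (insert 0 ?R) = Suc k"
    using assms by (subst card_insert_disjoint) (auto simp: power_0_left)
  have "degree (\<Prod>w\<in>?R. [:1, - w:]) \<le> (\<Sum>w\<in>?R. degree [:1, - w:])"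
    by (rule order_trans[OF degree_prod_sum_le[OF R(1)]]) simp
  also have "\<dots> \<le> (\<Sum>w\<in>?R. 1)"
    by (intro sum_mono) auto
  finally show "degree (\<Prod>w\<in>?R. [:1, - w:]) < card (insert 0 ?R)"
    using R card by simp
  have "degree (1 - monom (1::complex) k) \<le> k"
    by (intro degree_diff_le) (auto simp: degree_monom_le)
  then show "degree (1 - monom (1::complex) k) < card (insert 0 ?R)"
    using card by simp
  fix x assume "x \<in> insert 0 ?R"
  then show "poly (\<Prod>w\<in>?R. [:1, - w:]) x = poly (1 - monom 1 k) x"
  proof
    assume "x = 0"
    then show ?thesis using assms by (simp add: poly_prod poly_monom)
  next
    assume x: "x \<in> ?R"
    then have "inverse x \<in> ?R" "x \<noteq> 0" using assms by (auto simp: power_inverse power_0_left)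
    then have "(\<Prod>w\<in>?R. 1 - x * w) = 0"
      using R(1) by (intro prod_zero bexI[of _ "inverse x"]) auto
    then show ?thesis using x by (simp add: poly_prod poly_monom)
  qed
qed

text \<open>Carries the factorization over to any commutative ring that contains an image of
  \<open>complex\<close>; it is applied to power series, with \<open>fps_const (h w)\<close> in the
  role of the roots.\<close>

lemma prod_roots_unity_hom:
  fixes h :: "complex \<Rightarrow> 'b::comm_ring_1"
  assumes "comm_ring_hom h" "k > 0"
  shows "(\<Prod>w | w ^ k = 1. 1 - h w * y) = 1 - y ^ k"
proof -
  interpret comm_ring_hom h by fact
  interpret P: map_poly_comm_ring_hom h ..
  have "poly (map_poly h (\<Prod>w | w ^ k = 1. [:1, - w:])) y = poly (map_poly h (1 - monom 1 k)) y"
    by (simp add: prod_roots_unity_poly[OF assms(2)])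
  then show ?thesis
    by (simp add: hom_distribs poly_prod poly_monom mult.commute)
qed

lemma fps_compose_X_power_nth:
  assumes "k > 0"
  shows "(f oo fps_X ^ k) $ (k * j) = f $ j"
proof -
  have "(f oo fps_X ^ k) $ (k * j) = (\<Sum>i = 0..k * j. if i = j then f $ j else 0)"
    unfolding fps_compose_nth
    using assms by (intro sum.cong) (auto simp: fps_X_power_nth simp flip: power_mult)
  also have "\<dots> = f $ j" using assms by simp
  finally show ?thesis .
qed

lemma complete_gf_scale_nth: "complete_gf (map ((*) w) zs) $ n = w ^ n * complete_gf zs $ n"
proof (induction zs arbitrary: n)
  case Nil
  then show ?case by (cases n) auto
next
  case (Cons z zs)
  have "(\<Sum>i = 0..n. (w * z) ^ i * (w ^ (n - i) * complete_gf zs $ (n - i))) =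
      (\<Sum>i = 0..n. w ^ n * (z ^ i * complete_gf zs $ (n - i)))"
  proof (intro sum.cong refl)
    fix i assume "i \<in> {0..n}"
    then have "w ^ n = w ^ i * w ^ (n - i)" by (simp flip: power_add)
    then show "(w * z) ^ i * (w ^ (n - i) * complete_gf zs $ (n - i)) =
        w ^ n * (z ^ i * complete_gf zs $ (n - i))"
      by (simp add: power_mult_distrib mult_ac)
  qed
  then show ?case
    using Cons.IH by (simp add: fps_mult_nth geom_def sum_distrib_left)
qed

text \<open>Both sides are inverse to \<open>1 - (fps_const z * fps_X) ^ k\<close>, hence equal: on
  the left the linear factors of this binomial cancel one by one against the
  \<open>geom (h w * z)\<close>.\<close>

lemma prod_geom_roots_unity:
  fixes h :: "complex \<Rightarrow> 'b::idom"
  assumes "comm_ring_hom h" "k > 0"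
  shows "(\<Prod>w | w ^ k = 1. geom (h w * z)) = geom (z ^ k) oo fps_X ^ k"
proof -
  interpret comm_ring_hom h by fact
  have hom: "comm_ring_hom (\<lambda>w. fps_const (h w))"
    by unfold_locales (simp_all add: hom_distribs)
  define g where "g = (\<Prod>w | w ^ k = 1. geom (h w * z))"
  define g' where "g' = geom (z ^ k) oo fps_X ^ k"
  have X0: "(fps_X ^ k :: 'b fps) $ 0 = 0" using assms(2) by (simp add: fps_X_power_nth)
  have "(\<Prod>w | w ^ k = 1. 1 - fps_const (h w) * (fps_const z * fps_X)) = 1 - (fps_const z * fps_X) ^ k"
    by (rule prod_roots_unity_hom[OF hom assms(2)])
  then have "(1 - (fps_const z * fps_X) ^ k) * g =
      (\<Prod>w | w ^ k = 1. (1 - fps_const (h w * z) * fps_X) * geom (h w * z))"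
    unfolding g_def prod.distrib by (simp flip: mult.assoc fps_const_mult)
  also have "\<dots> = 1" by (simp add: geom_inverse)
  finally have 1: "(1 - (fps_const z * fps_X) ^ k) * g = 1" .
  have "((1 - fps_const (z ^ k) * fps_X) * geom (z ^ k)) oo fps_X ^ k = 1"
    by (simp add: geom_inverse)
  then have 2: "(1 - (fps_const z * fps_X) ^ k) * g' = 1"
    by (simp add: g'_def fps_compose_mult_distrib[OF X0] fps_compose_sub_distrib fps_X_fps_compose_startby0[OF X0] power_mult_distrib fps_const_power)
  have "g = g * ((1 - (fps_const z * fps_X) ^ k) * g')" using 2 by simp
  also have "\<dots> = ((1 - (fps_const z * fps_X) ^ k) * g) * g'" by (simp only: mult_ac)
  also have "\<dots> = g'" using 1 by simp
  finally show ?thesis unfolding g_def g'_def .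
qed

text \<open>The generating function of the powers \<open>z ^ k\<close> is a norm: with \<open>w\<close> ranging over the
  \<open>k\<close>-th roots of unity, \<open>H\<^sub>k (t ^ k) = (\<Prod>w. H (w * t))\<close>. This bounds its degree modulo an ideal.\<close>

lemma complete_gf_power_norm:
  fixes h :: "complex \<Rightarrow> 'b::idom"
  assumes "comm_ring_hom h" "k > 0"
  shows "(\<Prod>w | w ^ k = 1. complete_gf (map ((*) (h w)) zs)) = complete_gf (map (\<lambda>z. z ^ k) zs) oo fps_X ^ k"
proof (induction zs)
  case (Cons z zs)
  have X0: "(fps_X ^ k :: 'b fps) $ 0 = 0" using assms(2) by (simp add: fps_X_power_nth)
  show ?case
    using Cons by (simp add: prod.distrib prod_geom_roots_unity[OF assms] fps_compose_mult_distrib[OF X0])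
qed simp

text \<open>Scaling the variables multiplies coefficients by ring elements, so each of the
  \<open>k\<close> factors of the norm has degree at most \<open>c - 1\<close> modulo
  \<open>K\<close>. The norm then has degree at most \<open>k * (c - 1)\<close>, which is less than
  the position \<open>k * n\<close> of the wanted coefficient.\<close>

lemma complete_gf_power_mem:
  fixes K :: "'b::idom set"
  assumes "ring_ideal K" "comm_ring_hom (h :: complex \<Rightarrow> 'b)" "k > 0" "c > 0"
    and mem: "\<And>n. c \<le> n \<Longrightarrow> complete_gf zs $ n \<in> K" and "c \<le> n"
  shows "complete_gf (map (\<lambda>z. z ^ k) zs) $ n \<in> K"
proof -
  interpret ring_ideal K by fact
  have "(\<Prod>w | w ^ k = 1. complete_gf (map ((*) (h w)) zs)) $ (k * n) \<in> K"
  proof (rule fps_prod_nth_mem[where b = "c - 1"])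
    fix r n assume "c - 1 < n"
    then show "complete_gf (map ((*) (h r)) zs) $ n \<in> K"
      unfolding complete_gf_scale_nth using mem \<open>c > 0\<close> by (intro mult_mem) auto
  next
    have "k * (c - 1) < k * n" using assms(3,4,6) by simp
    then show "card {w::complex. w ^ k = 1} * (c - 1) < k * n"
      using assms(3) by (simp add: card_roots_unity_eq)
  qed (use assms(3) in \<open>auto simp: finite_roots_unity\<close>)
  then show ?thesis
    by (simp add: complete_gf_power_norm[OF assms(2,3)] fps_compose_X_power_nth[OF assms(3)])
qed

section \<open>Power sums and Newton's identities\<close>

definition power_sum :: "nat \<Rightarrow> 'a::comm_ring_1 list \<Rightarrow> 'a" where
  "power_sum k ys = sum_list (map (\<lambda>y. y ^ k) ys)"

lemma fps_deriv_geom: "fps_deriv (geom y) = fps_const y * geom y * geom y"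
proof -
  have "fps_deriv (geom y) = fps_deriv (1 + fps_const y * fps_X * geom y)"
    using geom_eq by metis
  then have "fps_deriv (geom y) = fps_const y * geom y + fps_const y * fps_X * fps_deriv (geom y)"
    by (simp add: algebra_simps)
  then have "(1 - fps_const y * fps_X) * fps_deriv (geom y) = fps_const y * geom y"
    by (simp add: algebra_simps)
  then have "((1 - fps_const y * fps_X) * geom y) * fps_deriv (geom y) = fps_const y * geom y * geom y"
    by (simp add: mult_ac)
  then show ?thesis by (simp add: geom_inverse)
qed

text \<open>Logarithmic derivative of a product: the factor of \<open>y\<close> contributes
  \<open>fps_const y * geom y\<close>, the generating function of the powers
  \<open>y ^ Suc n\<close>.\<close>

lemma fps_deriv_complete_gf:
  "fps_deriv (complete_gf ys) = Abs_fps (\<lambda>n. power_sum (Suc n) ys) * complete_gf ys"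
proof (induction ys)
  case Nil
  have "Abs_fps (\<lambda>n. power_sum (Suc n) ([] :: 'a list)) = 0"
    by (rule fps_ext) (simp add: power_sum_def)
  then show ?case by simp
next
  case (Cons y ys)
  have "Abs_fps (\<lambda>n. power_sum (Suc n) (y # ys)) = fps_const y * geom y + Abs_fps (\<lambda>n. power_sum (Suc n) ys)"
    by (rule fps_ext) (simp add: power_sum_def geom_def)
  then show ?case using Cons by (simp add: fps_deriv_geom algebra_simps)
qed

lemma newton_complete:
  "of_nat (Suc n) * complete_gf ys $ Suc n = (\<Sum>i\<le>n. power_sum (Suc i) ys * complete_gf ys $ (n - i))"
proof -
  have "fps_deriv (complete_gf ys) $ n = (\<Sum>i\<le>n. power_sum (Suc i) ys * complete_gf ys $ (n - i))"
    unfolding fps_deriv_complete_gf by (simp add: fps_mult_nth atLeast0AtMost)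
  then show ?thesis by simp
qed

text \<open>Newton's identities recover \<open>n\<close> times the \<open>n\<close>-th coefficient
  from power sums and lower coefficients, and characteristic 0 allows cancelling a positive
  \<open>n\<close>.\<close>

lemma complete_gf_eqI_power_sum:
  fixes ys zs :: "'b::{idom, ring_char_0} list"
  assumes "\<And>k. 0 < k \<Longrightarrow> power_sum k ys = power_sum k zs"
  shows "complete_gf ys = complete_gf zs"
proof (rule fps_ext)
  have nth0: "complete_gf us $ 0 = 1" for us :: "'b list"
    by (induction us) (simp_all add: geom_def)
  fix n show "complete_gf ys $ n = complete_gf zs $ n"
  proof (induction n rule: less_induct)
    case (less n)
    show ?case
    proof (cases n)
      case (Suc m)
      have "of_nat (Suc m) * complete_gf ys $ Suc m = of_nat (Suc m) * complete_gf zs $ Suc m"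
        unfolding newton_complete using less Suc assms by (intro sum.cong) auto
      then show ?thesis using Suc mult_cancel_left of_nat_neq_0 by metis
    qed (simp add: nth0)
  qed
qed

subsection \<open>Vandermonde colon ideals and plethysm\<close>

fun vandermonde :: "'a::comm_ring_1 list \<Rightarrow> 'a" where
  "vandermonde [] = 1"
| "vandermonde (z # zs) = prod_list (map (\<lambda>w. z - w) zs) * vandermonde zs"

lemma vandermonde_snoc: "vandermonde (zs @ [y]) = prod_list (map (\<lambda>w. w - y) zs) * vandermonde zs"
  by (induction zs) (simp_all add: mult_ac)

text \<open>Multiplying the full series by \<open>1 - y X\<close> removes \<open>y\<close>, by
  \<open>1 - z X\<close> removes \<open>z\<close>; the difference of the two multipliers is
  \<open>(z - y) X\<close>.\<close>

lemma complete_gf_difference: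
  "(z - y) * complete_gf (z # ws @ [y]) $ q = complete_gf (z # ws) $ Suc q - complete_gf (ws @ [y]) $ Suc q"
proof -
  let ?H = "complete_gf (z # ws @ [y])"
  have 1: "(1 - fps_const y * fps_X) * ?H = complete_gf (z # ws)"
  proof -
    have "(1 - fps_const y * fps_X) * ?H = complete_gf (z # ws) * ((1 - fps_const y * fps_X) * geom y)"
      by (simp add: mult_ac)
    then show ?thesis by (simp add: geom_inverse)
  qed
  have 2: "(1 - fps_const z * fps_X) * ?H = complete_gf (ws @ [y])"
  proof -
    have "(1 - fps_const z * fps_X) * ?H = complete_gf (ws @ [y]) * ((1 - fps_const z * fps_X) * geom z)"
      by (simp add: mult_ac)
    then show ?thesis by (simp add: geom_inverse)
  qed
  have "complete_gf (z # ws) - complete_gf (ws @ [y]) = fps_const (z - y) * (fps_X * ?H)"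
    unfolding 1[symmetric] 2[symmetric]
    by (simp add: algebra_simps del: complete_gf_simps flip: fps_const_sub)
  then have "(complete_gf (z # ws) - complete_gf (ws @ [y])) $ Suc q = (z - y) * ?H $ q"
    by (simp del: complete_gf_simps)
  then show ?thesis by simp
qed

context ring_ideal
begin

lemma diff_mem: "f \<in> K \<Longrightarrow> g \<in> K \<Longrightarrow> f - g \<in> K"
  using add_mem[of f "- 1 * g"] mult_mem[of g "- 1"] by simp

text \<open>The factor \<open>z - y\<close> of the Vandermonde product, for the first and last
  variable, is spent on \<open>complete_gf_difference\<close>: one variable is lost and the degree
  rises by one, so \<open>q + length zs\<close> is invariant. With one variable left the polynomial
  is \<open>z ^ q\<close> with \<open>N <= q\<close>.\<close>

lemma complete_gf_vandermonde_mem: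
  assumes "\<And>z. z \<in> set zs \<Longrightarrow> z ^ N \<in> K" "zs \<noteq> []" "N < q + length zs"
  shows "complete_gf zs $ q * vandermonde zs \<in> K"
  using assms
proof (induction "length zs" arbitrary: zs q rule: less_induct)
  case less
  obtain z zs' where zs: "zs = z # zs'" using less.prems(2) by (cases zs) auto
  show ?case
  proof (cases zs' rule: rev_cases)
    case Nil
    then have "N \<le> q" using less.prems(3) zs by simp
    then have "z ^ q = z ^ (q - N) * z ^ N" by (simp flip: power_add)
    then show ?thesis using mult_mem[OF less.prems(1)[of z]] zs Nil by (simp add: geom_def)
  next
    case (snoc ws y)
    let ?A = "prod_list (map (\<lambda>w. z - w) ws)" and ?B = "prod_list (map (\<lambda>w. w - y) ws)"
    let ?u = "complete_gf (z # ws) $ Suc q" and ?v = "complete_gf (ws @ [y]) $ Suc q"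
    have "?u * vandermonde (z # ws) \<in> K"
      by (rule less.hyps) (use less.prems zs snoc in auto)
    then have 1: "?B * (?u * vandermonde (z # ws)) \<in> K" by (rule mult_mem)
    have "?v * vandermonde (ws @ [y]) \<in> K"
      by (rule less.hyps) (use less.prems zs snoc in auto)
    then have 2: "?A * (?v * vandermonde (ws @ [y])) \<in> K" by (rule mult_mem)
    have "complete_gf zs $ q * vandermonde zs = ((z - y) * complete_gf (z # ws @ [y]) $ q) * (?A * ?B * vandermonde ws)"
      by (simp add: zs snoc vandermonde_snoc mult_ac)
    also have "\<dots> = ?B * (?u * vandermonde (z # ws)) - ?A * (?v * vandermonde (ws @ [y]))"
      unfolding complete_gf_difference vandermonde_snoc by (simp add: algebra_simps)
    finally show ?thesis using diff_mem[OF 1 2] by simp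
  qed
qed

lemma colon_ideal: "ring_ideal {f. f * v \<in> K}"
proof
  show "g * f \<in> {f. f * v \<in> K}" if "f \<in> {f. f * v \<in> K}" for f g
    using mult_mem[of "f * v" g] that by (simp add: mult.assoc)
qed (auto simp: zero_mem add_mem distrib_right)

end

text \<open>Newton's identities put \<open>n\<close> times the coefficient into \<open>K\<close>;
  the image of \<open>1/n\<close> under \<open>h\<close> removes the factor.\<close>

lemma complete_gf_mem_power_sum:
  fixes K :: "'b::comm_ring_1 set"
  assumes "ring_ideal K" "comm_ring_hom (h :: complex \<Rightarrow> 'b)"
    and mem: "\<And>k. 0 < k \<Longrightarrow> power_sum k ys \<in> K" and "0 < n"
  shows "complete_gf ys $ n \<in> K"
proof -
  interpret ring_ideal K by fact
  interpret comm_ring_hom h by fact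
  obtain m where n: "n = Suc m" using \<open>0 < n\<close> by (cases n) auto
  have "of_nat n * complete_gf ys $ n \<in> K"
    unfolding n newton_complete by (intro sum_mem mult_mem' mem) simp
  then have "h (inverse (of_nat n)) * (of_nat n * complete_gf ys $ n) \<in> K" by (rule mult_mem)
  moreover have "h (inverse (of_nat n)) * of_nat n = h (inverse (of_nat n) * of_nat n)"
    by (simp add: hom_mult hom_of_nat)
  ultimately show ?thesis using n by (simp flip: mult.assoc del: of_nat_Suc)
qed

text \<open>Modulo \<open>K\<close>, the series \<open>complete_gf zs\<close> has degree below \<open>c\<close>; the hypothesis on
  \<open>ys\<close> says that its power sums are the Adams operations \<open>s\<^bsub>nu\<^esub>(x\<^sup>k)\<close>.\<close>

lemma plethysm_mem:
  fixes K :: "'b::idom set"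
  assumes K: "ring_ideal K" and h: "comm_ring_hom (h :: complex \<Rightarrow> 'b)"
    and nu: "sorted_wrt (\<ge>) nu" "c \<le> part nu (length xs)" "0 < c"
    and mem: "\<And>n. c \<le> n \<Longrightarrow> complete_gf zs $ n \<in> K"
    and vs: "mset vs = mset (zs @ xs)"
    and ys: "\<And>k. 0 < k \<Longrightarrow> power_sum k ys = schur_at nu (map (\<lambda>v. v ^ k) vs)"
    and mu: "is_partition mu" "mu \<noteq> []"
  shows "schur_at mu ys \<in> K"
proof -
  interpret ring_ideal K by fact
  have "power_sum k ys \<in> K" if k: "0 < k" for k
  proof -
    \<comment> \<open>Taking powers keeps the number of letters of \<open>xs\<close>, and
      \<open>complete_gf_power_mem\<close> gives the powers of \<open>zs\<close> the same bound
      \<open>c\<close>, so the row condition on \<open>nu\<close> applies unchanged.\<close>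
    have "schur_at nu (map (\<lambda>v. v ^ k) zs @ map (\<lambda>v. v ^ k) xs) \<in> K"
      by (rule schur_at_mem_append[OF nu(1) _ nu(3) complete_gf_power_mem[OF K h k nu(3) mem]])
        (use nu(2) in auto)
    moreover have "mset (map (\<lambda>v. v ^ k) vs) = mset (map (\<lambda>v. v ^ k) (zs @ xs))"
      unfolding mset_map vs ..
    then have "schur_at nu (map (\<lambda>v. v ^ k) vs) = schur_at nu (map (\<lambda>v. v ^ k) (zs @ xs))"
      by (rule schur_at_mset[OF nu(1)])
    ultimately show ?thesis using ys[OF k] by simp
  qed
  then have "complete_gf ys $ n \<in> K" if "1 \<le> n" for n
    using complete_gf_mem_power_sum[OF K h] that by simp
  \<comment> \<open>As \<open>mu\<close> is nonempty, its first row is positive, and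
    \<open>schur_at_mem_first_row\<close> applies with bound 1.\<close>
  moreover have "1 \<le> part mu 0"
    using mu by (cases mu) (auto simp: part_def is_partition_def)
  ultimately show ?thesis
    using schur_at_mem_first_row[of mu 1 ys] mu by (simp add: is_partition_def)
qed

subsection \<open>Evaluation and symmetry\<close>

abbreviation lookup where "lookup \<equiv> Poly_Mapping.lookup"
abbreviation single where "single \<equiv> Poly_Mapping.single"
abbreviation keys where "keys \<equiv> Poly_Mapping.keys"

text \<open>The variables over any coefficient ring: the plethysm is an \<open>ipoly\<close>, while
  the ideal argument runs over \<open>complex\<close>.\<close>

definition indet :: "nat \<Rightarrow> (nat \<Rightarrow>\<^sub>0 nat) \<Rightarrow>\<^sub>0 'c::comm_ring_1" where
  "indet i = single (single i 1) 1"

lemma indet_eq_var: "indet = var"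
  by (rule ext) (simp add: indet_def var_def)

lemma prod_single_one: "(\<Prod>c\<in>A. single (e c) (1::'c::comm_ring_1)) = single (\<Sum>c\<in>A. e c) 1"
  by (induction A rule: infinite_finite_induct) (simp_all add: mult_single)

lemma indet_power: "(indet i :: (nat \<Rightarrow>\<^sub>0 nat) \<Rightarrow>\<^sub>0 'c::comm_ring_1) ^ n = single (single i n) 1"
  by (induction n) (simp_all add: indet_def mult_single single_add[symmetric])

lemma sum_single_lookup: "f = (\<Sum>t\<in>keys f. single t (lookup f t))"
proof (rule poly_mapping_eqI)
  fix t show "lookup f t = lookup (\<Sum>t\<in>keys f. single t (lookup f t)) t"
    by (cases "t \<in> keys f") (simp_all add: lookup_sum lookup_single when_def in_keys_iff)
qed

definition eval_monomial :: "(nat \<Rightarrow> 'b::comm_ring_1) \<Rightarrow> (nat \<Rightarrow>\<^sub>0 nat) \<Rightarrow> 'b" where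
  "eval_monomial g t = (\<Prod>i\<in>keys t. g i ^ lookup t i)"

definition eval_ipoly :: "(nat \<Rightarrow> 'b::comm_ring_1) \<Rightarrow> ipoly \<Rightarrow> 'b" where
  "eval_ipoly g f = (\<Sum>t\<in>keys f. of_int (lookup f t) * eval_monomial g t)"

lemma eval_monomial_add: "eval_monomial g (s + t) = eval_monomial g s * eval_monomial g t"
proof -
  have *: "eval_monomial g u = (\<Prod>i\<in>keys s \<union> keys t. g i ^ lookup u i)"
    if "keys u \<subseteq> keys s \<union> keys t" for u
    unfolding eval_monomial_def using that
    by (intro prod.mono_neutral_left) (auto simp: in_keys_iff)
  show ?thesis
    using *[of s] *[of t] *[of "s + t"] keys_add[of s t]
    by (simp add: lookup_add power_add prod.distrib)
qed

lemma eval_ipoly_add: "eval_ipoly g (f + f') = eval_ipoly g f + eval_ipoly g f'"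
  unfolding eval_ipoly_def
  by (rule setsum_keys_plus_distrib[of "\<lambda>t c. of_int c * eval_monomial g t"])
     (simp_all add: distrib_right)

lemma eval_ipoly_zero: "eval_ipoly g 0 = 0"
  by (simp add: eval_ipoly_def)

lemma eval_ipoly_sum: "eval_ipoly g (sum F A) = (\<Sum>a\<in>A. eval_ipoly g (F a))"
  by (induction A rule: infinite_finite_induct) (simp_all add: eval_ipoly_add eval_ipoly_zero)

lemma eval_ipoly_single: "eval_ipoly g (single t c) = of_int c * eval_monomial g t"
  by (simp add: eval_ipoly_def)

lemma eval_ipoly_mult: "eval_ipoly g (f * f') = eval_ipoly g f * eval_ipoly g f'"
proof -
  have "f * f' = (\<Sum>t\<in>keys f. \<Sum>s\<in>keys f'. single (t + s) (lookup f t * lookup f' s))"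
    by (subst sum_single_lookup[of f], subst sum_single_lookup[of f'])
       (simp add: sum_product mult_single)
  also have "eval_ipoly g \<dots> = eval_ipoly g f * eval_ipoly g f'"
    by (simp add: eval_ipoly_sum eval_ipoly_single eval_monomial_add)
       (simp add: eval_ipoly_def sum_product mult_ac)
  finally show ?thesis .
qed

lemma comm_ring_hom_eval_ipoly: "comm_ring_hom (eval_ipoly g)"
proof
  show "eval_ipoly g 1 = 1"
    using eval_ipoly_single[of g 0 1] by (simp add: eval_monomial_def)
qed (simp_all add: eval_ipoly_add eval_ipoly_zero eval_ipoly_mult)

lemma eval_ipoly_var: "eval_ipoly g (var i) = g i"
  by (simp add: var_def eval_ipoly_single eval_monomial_def)

lemma (in comm_ring_hom) hom_schur_at: "hom (schur_at lam ys) = schur_at lam (map hom ys)"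
  unfolding schur_at_def hom_sum hom_prod length_map
  by (intro sum.cong prod.cong refl nth_map[symmetric]) (auto simp: ssyt_def)

lemma eval_schur_poly: "eval_ipoly g (schur_poly n lam) = schur_at lam (map g [0..<n])"
proof -
  interpret comm_ring_hom "eval_ipoly g" by (rule comm_ring_hom_eval_ipoly)
  show ?thesis
    by (simp add: schur_poly_def hom_schur_at comp_def eval_ipoly_var)
qed

lemma plethysm_poly_obtain:
  obtains ts where "distinct ts" "set ts = ssyt nu n"
    "plethysm_poly n mu nu = schur_at mu (map (tab_monomial nu) ts)"
proof -
  define ts where "ts = (SOME ts. distinct ts \<and> set ts = ssyt nu n)"
  have "\<exists>ts. distinct ts \<and> set ts = ssyt nu n"
    using finite_distinct_list[OF finite_ssyt] by metis
  then have "distinct ts \<and> set ts = ssyt nu n"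
    unfolding ts_def by (rule someI_ex)
  moreover have "plethysm_poly n mu nu = schur_at mu (map (tab_monomial nu) ts)"
    by (simp add: plethysm_poly_def ts_def)
  ultimately show ?thesis using that by blast
qed

text \<open>The \<open>k\<close>-th power of a tableau monomial is the same monomial in the
  \<open>k\<close>-th powers of the variables. The homomorphism lets one proof serve for
  \<open>ipoly\<close> itself and for its images.\<close>

lemma power_sum_tab_monomial:
  fixes hom :: "ipoly \<Rightarrow> 'b::comm_ring_1"
  assumes "comm_ring_hom hom" "distinct ts" "set ts = ssyt nu n" and hom_var: "\<And>i. hom (var i) = g i"
  shows "power_sum k (map (\<lambda>T. hom (tab_monomial nu T)) ts) = schur_at nu (map (\<lambda>i. g i ^ k) [0..<n])"
proof -
  interpret comm_ring_hom hom by fact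
  have "power_sum k (map (\<lambda>T. hom (tab_monomial nu T)) ts) = (\<Sum>T\<in>ssyt nu n. hom (tab_monomial nu T) ^ k)"
    using assms(2,3) by (simp add: power_sum_def comp_def sum_list_distinct_conv_sum_set)
  also have "\<dots> = (\<Sum>T\<in>ssyt nu n. \<Prod>c\<in>diagram nu. map (\<lambda>i. g i ^ k) [0..<n] ! T c)"
    unfolding tab_monomial_def hom_prod prod_power_distrib hom_var
    by (intro sum.cong prod.cong refl) (auto simp: ssyt_def)
  finally show ?thesis by (simp add: schur_at_def)
qed

lemma mset_map_transpose:
  assumes "a < n" "b < n"
  shows "mset (map (\<lambda>i. F (transpose a b i)) [0..<n]) = mset (map F [0..<n])"
proof -
  have "transpose a b permutes {0..<n}"
    using assms by (intro permutes_swap_id) auto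
  then have "image_mset (transpose a b) (mset_set {0..<n}) = mset_set {0..<n}"
    by (rule permutes_image_mset)
  then have "image_mset F (image_mset (transpose a b) (mset_set {0..<n})) = image_mset F (mset_set {0..<n})"
    by simp
  then show ?thesis by (simp add: image_mset.compositionality comp_def)
qed

text \<open>Transpositions generate the symmetric group, so invariance under them is full
  symmetry.\<close>

definition symmetric_ipoly :: "nat \<Rightarrow> ipoly \<Rightarrow> bool" where
  "symmetric_ipoly n f \<longleftrightarrow> (\<forall>a b. a < n \<longrightarrow> b < n \<longrightarrow> eval_ipoly (\<lambda>i. var (transpose a b i)) f = f)"

lemma symmetric_schur_poly:
  assumes "sorted_wrt (\<ge>) lam"
  shows "symmetric_ipoly n (schur_poly n lam)"
  unfolding symmetric_ipoly_def eval_schur_poly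
  unfolding schur_poly_def
  by (intro allI impI schur_at_mset[OF assms] mset_map_transpose)

text \<open>A transposition rearranges the monomials of \<open>s_nu\<close>, which is seen through
  power sums: these are values of the symmetric \<open>s_nu\<close> and stay fixed. So
  \<open>complete_gf\<close> of the list of monomials is unchanged, and with it the value of
  \<open>s_mu\<close>.\<close>

lemma symmetric_plethysm_poly:
  assumes "sorted_wrt (\<ge>) mu" "sorted_wrt (\<ge>) nu"
  shows "symmetric_ipoly n (plethysm_poly n mu nu)"
  unfolding symmetric_ipoly_def
proof (intro allI impI)
  fix a b assume ab: "a < n" "b < n"
  obtain ts where ts: "distinct ts" "set ts = ssyt nu n"
    "plethysm_poly n mu nu = schur_at mu (map (tab_monomial nu) ts)"
    by (rule plethysm_poly_obtain)
  define g where "g = (\<lambda>i. var (transpose a b i))"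
  interpret comm_ring_hom "eval_ipoly g" by (rule comm_ring_hom_eval_ipoly)
  have id: "comm_ring_hom (\<lambda>f::ipoly. f)" by unfold_locales simp_all
  have "complete_gf (map (\<lambda>T. eval_ipoly g (tab_monomial nu T)) ts) = complete_gf (map (tab_monomial nu) ts)"
  proof (rule complete_gf_eqI_power_sum)
    fix k :: nat
    have "schur_at nu (map (\<lambda>i. g i ^ k) [0..<n]) = schur_at nu (map (\<lambda>i. var i ^ k) [0..<n])"
      unfolding g_def by (rule schur_at_mset[OF assms(2) mset_map_transpose[OF ab]])
    then show "power_sum k (map (\<lambda>T. eval_ipoly g (tab_monomial nu T)) ts) = power_sum k (map (tab_monomial nu) ts)"
      by (simp add: power_sum_tab_monomial[OF comm_ring_hom_eval_ipoly ts(1,2) eval_ipoly_var]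
        power_sum_tab_monomial[OF id ts(1,2) refl])
  qed
  then have "eval_ipoly g (plethysm_poly n mu nu) = plethysm_poly n mu nu"
    using schur_at_cong_complete_gf[OF assms(1)] by (simp add: ts(3) hom_schur_at comp_def)
  then show "eval_ipoly (\<lambda>i. var (transpose a b i)) (plethysm_poly n mu nu) = plethysm_poly n mu nu"
    by (simp add: g_def)
qed

definition swap_exponents :: "nat \<Rightarrow> nat \<Rightarrow> (nat \<Rightarrow>\<^sub>0 nat) \<Rightarrow> nat \<Rightarrow>\<^sub>0 nat" where
  "swap_exponents a b t = (\<Sum>i\<in>keys t. single (transpose a b i) (lookup t i))"

lemma lookup_swap_exponents: "lookup (swap_exponents a b t) i = lookup t (transpose a b i)"
proof -
  have "lookup (swap_exponents a b t) i = (\<Sum>k\<in>keys t. if k = transpose a b i then lookup t k else 0)"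
    unfolding swap_exponents_def lookup_sum
    by (intro sum.cong) (auto simp: lookup_single when_def)
  also have "\<dots> = lookup t (transpose a b i)"
    by (simp add: in_keys_iff)
  finally show ?thesis .
qed

lemma symmetric_ipoly_lookup:
  assumes "symmetric_ipoly n f" "a < n" "b < n"
  shows "lookup f (swap_exponents a b t) = lookup f t"
proof -
  have inj: "swap_exponents a b s = swap_exponents a b t \<longleftrightarrow> s = t" for s
  proof
    assume "swap_exponents a b s = swap_exponents a b t"
    then have "lookup s (transpose a b (transpose a b i)) = lookup t (transpose a b (transpose a b i))" for i
      by (metis lookup_swap_exponents)
    then show "s = t" by (intro poly_mapping_eqI) simp
  qed simp
  have "f = eval_ipoly (\<lambda>i. var (transpose a b i)) f"
    using assms by (simp add: symmetric_ipoly_def)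
  also have "\<dots> = (\<Sum>s\<in>keys f. single (swap_exponents a b s) (lookup f s))"
    unfolding eval_ipoly_def eval_monomial_def indet_eq_var[symmetric] indet_power prod_single_one
    by (intro sum.cong refl) (simp add: swap_exponents_def mult_single flip: single_of_int)
  finally have "lookup f (swap_exponents a b t) =
      lookup (\<Sum>s\<in>keys f. single (swap_exponents a b s) (lookup f s)) (swap_exponents a b t)"
    by (rule arg_cong)
  also have "\<dots> = (\<Sum>s\<in>keys f. if s = t then lookup f s else 0)"
    by (simp add: lookup_sum lookup_single when_def inj)
  finally show ?thesis by (simp add: in_keys_iff)
qed

subsection \<open>Leading monomials\<close>

text \<open>Exponents are ordered lexicographically, the lowest index that differs deciding.
  \<open>c\<close> may be 0; \<open>t\<close> is then a mere upper bound.\<close>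

definition is_lead :: "((nat \<Rightarrow>\<^sub>0 nat) \<Rightarrow>\<^sub>0 'c::comm_ring_1) \<Rightarrow> (nat \<Rightarrow>\<^sub>0 nat) \<Rightarrow> 'c \<Rightarrow> bool" where
  "is_lead f t c \<longleftrightarrow> keys f \<subseteq> {..t} \<and> lookup f t = c"

lemma is_lead_remainder:
  assumes "is_lead f t c" "s \<in> keys (f - single t c)"
  shows "s < t"
proof -
  have "s \<noteq> t" "s \<in> keys f"
    using assms by (auto simp: is_lead_def in_keys_iff lookup_minus lookup_single when_def split: if_splits)
  moreover from this have "s \<le> t" using assms(1) by (auto simp: is_lead_def)
  ultimately show ?thesis by simp
qed

text \<open>Adding exponents preserves the strict order, so only the product of the two leading
  terms reaches \<open>t + u\<close>. Allowing zero coefficients makes this valid in rings with zero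
  divisors.\<close>

lemma is_lead_mult:
  assumes "is_lead f t a" "is_lead g u b"
  shows "is_lead (f * g) (t + u) (a * b)"
proof -
  define f' where "f' = f - single t a"
  define g' where "g' = g - single u b"
  define r where "r = single t a * g' + f' * g"
  have f: "f = single t a + f'" and g: "g = single u b + g'"
    by (simp_all add: f'_def g'_def)
  have "f * g = single t a * g + f' * g"
    by (subst f) (rule distrib_right)
  also have "single t a * g = single (t + u) (a * b) + single t a * g'"
    by (subst g) (simp only: distrib_left mult_single)
  finally have fg: "f * g = single (t + u) (a * b) + r"
    by (simp only: r_def add.assoc)
  have r: "s < t + u" if "s \<in> keys r" for s
  proof -
    have "s \<in> keys (single t a * g') \<or> s \<in> keys (f' * g)"
      using that keys_add[of "single t a * g'" "f' * g"] unfolding r_def by blast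
    then show ?thesis
    proof
      assume "s \<in> keys (single t a * g')"
      then obtain x y where "x \<in> keys (single t a)" "y \<in> keys g'" "s = x + y"
        using keys_mult[of "single t a" g'] by blast
      then show ?thesis
        using is_lead_remainder[OF assms(2)] unfolding g'_def
        by (auto simp: add_strict_left_mono split: if_splits)
    next
      assume "s \<in> keys (f' * g)"
      then obtain x y where xy: "x \<in> keys f'" "y \<in> keys g" "s = x + y"
        using keys_mult[of f' g] by blast
      then have "x < t" "y \<le> u"
        using is_lead_remainder[OF assms(1)] assms(2) unfolding f'_def by (auto simp: is_lead_def)
      then show ?thesis unfolding xy(3) by (rule add_less_le_mono)
    qed
  qed
  have "s \<le> t + u" if "s \<in> keys (f * g)" for s
  proof (cases "s \<in> keys r")
    case False
    then have "s \<in> keys (single (t + u) (a * b))"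
      using that keys_add[of "single (t + u) (a * b)" r] unfolding fg by blast
    then show ?thesis by (simp split: if_splits)
  qed (use r in \<open>simp add: less_imp_le\<close>)
  moreover have "t + u \<notin> keys r" using r by blast
  then have "lookup (f * g) (t + u) = a * b"
    unfolding fg lookup_add by (simp add: in_keys_iff)
  ultimately show ?thesis by (auto simp: is_lead_def)
qed

lemma lookup_of_int_mult: "lookup (of_int c * f) t = of_int c * lookup f t"
proof -
  have nat: "lookup (of_nat n * f) t = of_nat n * lookup f t" for n
    by (induction n) (simp_all add: distrib_right lookup_add)
  show ?thesis by (cases c) (simp_all add: nat lookup_minus left_diff_distrib lookup_add distrib_right)
qed

lemma is_lead_one: "is_lead 1 0 1"
  by (simp add: is_lead_def)

lemma single_less_single:
  fixes a b :: nat assumes "a < b" shows "single b (1::nat) < single a 1"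
  unfolding less_poly_mapping.rep_eq less_fun_def
  using assms by (intro exI[of _ a]) (auto simp: lookup_single when_def)

lemma is_lead_indet_diff:
  assumes "a < b"
  shows "is_lead (indet a - indet b :: (nat \<Rightarrow>\<^sub>0 nat) \<Rightarrow>\<^sub>0 'c::comm_ring_1) (single a 1) 1"
  using single_less_single[OF assms]
  by (auto simp: is_lead_def indet_def lookup_minus lookup_single when_def in_keys_iff split: if_splits)

lemma is_lead_prod_indet_diff:
  assumes "\<And>b. b \<in> set bs \<Longrightarrow> a < b"
  shows "is_lead (prod_list (map (\<lambda>w. indet a - w) (map indet bs)) :: (nat \<Rightarrow>\<^sub>0 nat) \<Rightarrow>\<^sub>0 'c::comm_ring_1)
    (single a (length bs)) 1"
  using assms
proof (induction bs)
  case (Cons b bs)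
  then have "is_lead ((indet a - indet b) * prod_list (map (\<lambda>w. indet a - w) (map indet bs)) ::
      (nat \<Rightarrow>\<^sub>0 nat) \<Rightarrow>\<^sub>0 'c) (single a 1 + single a (length bs)) (1 * 1)"
    by (intro is_lead_mult is_lead_indet_diff) auto
  then show ?case by (simp flip: single_add)
qed (simp add: is_lead_one)

lemma is_lead_vandermonde:
  assumes "sorted_wrt (<) bs"
  obtains e where "is_lead (vandermonde (map indet bs) :: (nat \<Rightarrow>\<^sub>0 nat) \<Rightarrow>\<^sub>0 'c::comm_ring_1) e 1"
    "\<And>b. lookup e b < max 1 (length bs)"
proof -
  \<comment> \<open>The support condition is added for the induction: it keeps \<open>e\<close> from
    raising the exponent of the new variable \<open>a\<close>. The \<open>max 1\<close> covers the
    empty list, where all exponents are 0.\<close>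
  have "\<exists>e. is_lead (vandermonde (map indet bs) :: (nat \<Rightarrow>\<^sub>0 nat) \<Rightarrow>\<^sub>0 'c::comm_ring_1) e 1 \<and>
      keys e \<subseteq> set bs \<and> (\<forall>b. lookup e b < max 1 (length bs))"
    using assms
  proof (induction bs)
    case Nil
    then show ?case by (intro exI[of _ 0]) (simp add: is_lead_one)
  next
    case (Cons a bs)
    then obtain e where e: "is_lead (vandermonde (map indet bs) :: (nat \<Rightarrow>\<^sub>0 nat) \<Rightarrow>\<^sub>0 'c) e 1"
      "keys e \<subseteq> set bs" "\<And>b. lookup e b < max 1 (length bs)" by auto
    have "is_lead (vandermonde (map indet (a # bs)) :: (nat \<Rightarrow>\<^sub>0 nat) \<Rightarrow>\<^sub>0 'c) (single a (length bs) + e) (1 * 1)"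
    proof -
      have "is_lead (prod_list (map (\<lambda>w. indet a - w) (map indet bs)) :: (nat \<Rightarrow>\<^sub>0 nat) \<Rightarrow>\<^sub>0 'c) (single a (length bs)) 1"
        using Cons.prems by (intro is_lead_prod_indet_diff) auto
      from is_lead_mult[OF this e(1)] show ?thesis by (simp add: comp_def)
    qed
    moreover have "lookup (single a (length bs) + e) b < max 1 (length (a # bs))" for b
    proof (cases "b = a")
      case True
      have "a \<notin> keys e" using e(2) Cons.prems by auto
      then show ?thesis using True by (simp add: lookup_add in_keys_iff)
    next
      case False
      then show ?thesis using e(3)[of b] by (auto simp: lookup_add lookup_single)
    qed
    moreover have "keys (single a (length bs) + e) \<subseteq> set (a # bs)"
      using keys_add[of "single a (length bs)" e] e(2) by (auto split: if_splits)
    ultimately show ?case by (metis mult_1)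
  qed
  then show ?thesis using that by blast
qed

section \<open>Leading monomials of Schur polynomials\<close>

definition exponents :: "nat list \<Rightarrow> nat \<Rightarrow>\<^sub>0 nat" where
  "exponents lam = (\<Sum>i<length lam. single i (lam ! i))"

lemma lookup_exponents [simp]: "lookup (exponents lam) i = part lam i"
proof -
  have "lookup (exponents lam) i = (\<Sum>k<length lam. if k = i then lam ! i else 0)"
    unfolding exponents_def lookup_sum by (intro sum.cong) (auto simp: lookup_single when_def)
  then show ?thesis by (simp add: part_def)
qed

definition weight :: "nat list \<Rightarrow> (nat \<times> nat \<Rightarrow> nat) \<Rightarrow> nat \<Rightarrow>\<^sub>0 nat" where
  "weight lam T = (\<Sum>c\<in>diagram lam. single (T c) 1)"

lemma lookup_weight: "lookup (weight lam T) v = card {c \<in> diagram lam. T c = v}"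
proof -
  have "lookup (weight lam T) v = (\<Sum>c\<in>diagram lam. if T c = v then 1 else 0)"
    unfolding weight_def lookup_sum by (intro sum.cong) (auto simp: lookup_single when_def)
  then show ?thesis by (simp add: card_eq_sum sum.inter_filter del: sum_constant One_nat_def)
qed

lemma schur_at_indet:
  "schur_at lam (map indet [0..<n]) = (\<Sum>T\<in>ssyt lam n. single (weight lam T) (1::'c::comm_ring_1))"
  unfolding schur_at_def
proof (intro sum.cong)
  fix T assume "T \<in> ssyt lam n"
  then have "(\<Prod>c\<in>diagram lam. map indet [0..<n] ! T c) = (\<Prod>c\<in>diagram lam. single (single (T c) 1) (1::'c))"
    by (intro prod.cong) (auto simp: ssyt_def indet_def)
  also have "\<dots> = single (weight lam T) 1"
    unfolding weight_def by (rule prod_single_one)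
  finally show "(\<Prod>c\<in>diagram lam. map indet [0..<n] ! T c) = single (weight lam T) (1::'c)" .
qed simp

definition superstandard :: "nat list \<Rightarrow> nat \<times> nat \<Rightarrow> nat" where
  "superstandard lam c = (if c \<in> diagram lam then snd c else 0)"

lemma superstandard_ssyt:
  assumes "sorted_wrt (\<ge>) lam" "length lam \<le> n"
  shows "superstandard lam \<in> ssyt lam n"
proof -
  have "snd c < n" if "c \<in> diagram lam" for c
    using that assms(2) by (auto simp: diagram_def part_def split: if_splits)
  moreover have "(j, i) \<in> diagram lam" if "(j, Suc i) \<in> diagram lam" for i j
    using that part_mono[OF assms(1), of i "Suc i"] by (auto simp: diagram_def)
  ultimately show ?thesis by (auto simp: ssyt_def superstandard_def)
qed

lemma card_row: "card {c \<in> diagram lam. snd c = v} = part lam v"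
proof -
  have "{c \<in> diagram lam. snd c = v} = (\<lambda>j. (j, v)) ` {..<part lam v}"
    by (auto simp: diagram_def)
  then show ?thesis by (simp add: card_image inj_on_def)
qed

lemma weight_superstandard: "weight lam (superstandard lam) = exponents lam"
proof (rule poly_mapping_eqI)
  fix v
  have "{c \<in> diagram lam. superstandard lam c = v} = {c \<in> diagram lam. snd c = v}"
    by (auto simp: superstandard_def)
  then show "lookup (weight lam (superstandard lam)) v = lookup (exponents lam) v"
    by (simp add: lookup_weight card_row)
qed

lemma ssyt_ge_row:
  assumes "sorted_wrt (\<ge>) lam" "T \<in> ssyt lam n" "(j, i) \<in> diagram lam"
  shows "i \<le> T (j, i)"
  using assms(3)
proof (induction i)
  case (Suc i)
  then have "(j, i) \<in> diagram lam"
    using part_mono[OF assms(1), of i "Suc i"] by (auto simp: diagram_def)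
  moreover have "T (j, i) < T (j, Suc i)" using assms(2) Suc.prems by (auto simp: ssyt_def)
  ultimately show ?case using Suc.IH by simp
qed simp

text \<open>Compare with the first row that is not filled with its own index: smaller letters occur
  exactly as often as in the superstandard tableau, and this letter occurs less often.\<close>

lemma weight_less_exponents:
  assumes "sorted_wrt (\<ge>) lam" "T \<in> ssyt lam n" "T \<noteq> superstandard lam"
  shows "weight lam T < exponents lam"
proof -
  let ?P = "\<lambda>v. \<exists>c\<in>diagram lam. snd c = v \<and> T c \<noteq> v"
  have "\<exists>v. ?P v"
  proof (rule ccontr)
    assume "\<not> (\<exists>v. ?P v)"
    then have "T = superstandard lam"
      using assms(2) unfolding superstandard_def ssyt_def by (intro ext) auto
    then show False using assms(3) by simp
  qed
  define v where "v = (LEAST v. ?P v)"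
  have v: "?P v" unfolding v_def using \<open>\<exists>v. ?P v\<close> by (rule LeastI_ex)
  have below: "T c = snd c" if "c \<in> diagram lam" "snd c < v" for c
    using not_less_Least[of "snd c" ?P] that unfolding v_def by blast
  have ge: "snd c \<le> T c" if "c \<in> diagram lam" for c
    using ssyt_ge_row[OF assms(1,2), of "fst c" "snd c"] that by simp
  \<comment> \<open>A letter \<open>u <= v\<close> occurs only in row \<open>u\<close>: rows before
    \<open>v\<close> carry their own index, and rows from \<open>v\<close> on have entries at least
    their index.\<close>
  have sub: "snd c = u" if "c \<in> diagram lam" "T c = u" "u \<le> v" for c u
    using ge[OF that(1)] below[OF that(1)] that by (cases "snd c < v") auto
  have "lookup (weight lam T) u = part lam u" if "u < v" for u
  proof -
    have "{c \<in> diagram lam. T c = u} = {c \<in> diagram lam. snd c = u}"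
      using sub[of _ u] below that by auto
    then show ?thesis by (simp add: lookup_weight card_row)
  qed
  moreover have "lookup (weight lam T) v < part lam v"
    unfolding lookup_weight card_row[symmetric] using v sub[of _ v]
    by (intro psubset_card_mono) auto
  ultimately show ?thesis
    unfolding less_poly_mapping.rep_eq less_fun_def by (intro exI[of _ v]) auto
qed

text \<open>Only the superstandard tableau has weight \<open>exponents lam\<close>, all other
  weights being smaller; it exists once there are at least \<open>length lam\<close>
  letters.\<close>

lemma is_lead_schur:
  assumes "sorted_wrt (\<ge>) lam" "length lam \<le> n"
  shows "is_lead (schur_at lam (map indet [0..<n]) :: (nat \<Rightarrow>\<^sub>0 nat) \<Rightarrow>\<^sub>0 'c::comm_ring_1) (exponents lam) 1"
proof -
  have "weight lam T = exponents lam \<longleftrightarrow> T = superstandard lam" if "T \<in> ssyt lam n" for T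
    using weight_less_exponents[OF assms(1) that] weight_superstandard[of lam]
    by (cases "T = superstandard lam") auto
  then have "lookup (schur_at lam (map indet [0..<n])) (exponents lam) =
      (\<Sum>T\<in>ssyt lam n. if T = superstandard lam then 1 else 0 :: 'c)"
    unfolding schur_at_indet lookup_sum by (intro sum.cong) (auto simp: lookup_single when_def)
  also have "\<dots> = 1" using superstandard_ssyt[OF assms] by simp
  finally have "lookup (schur_at lam (map indet [0..<n])) (exponents lam) = (1::'c)" .
  moreover have "s \<le> exponents lam" if s: "s \<in> keys (schur_at lam (map indet [0..<n]) :: (nat \<Rightarrow>\<^sub>0 nat) \<Rightarrow>\<^sub>0 'c)" for s
  proof -
    obtain T where "T \<in> ssyt lam n" "s = weight lam T"
      using s keys_sum[of "\<lambda>T. single (weight lam T) (1::'c)" "ssyt lam n"]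
      unfolding schur_at_indet by auto
    then show ?thesis
      using weight_less_exponents[OF assms(1), of T n] weight_superstandard[of lam]
      by (cases "T = superstandard lam") auto
  qed
  ultimately show ?thesis by (auto simp: is_lead_def)
qed

lemma is_partition_eqI:
  assumes "is_partition kap" "is_partition kap'" "\<And>i. part kap i = part kap' i"
  shows "kap = kap'"
proof -
  have len: "i < length k \<longleftrightarrow> part k i > 0" if "is_partition k" for k i
    using that by (auto simp: is_partition_def part_def)
  have "i < length kap \<longleftrightarrow> i < length kap'" for i
    using len[OF assms(1), of i] len[OF assms(2), of i] assms(3)[of i] by simp
  then have l: "length kap = length kap'" by (meson linorder_neqE_nat less_irrefl)
  then show ?thesis
  proof (intro nth_equalityI)
    fix i assume "i < length kap"
    then show "kap ! i = kap' ! i" using assms(3)[of i] l by (simp add: part_def)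
  qed
qed

text \<open>Different partitions have different leading exponents, so nothing cancels at the largest
  exponent among the shapes with nonzero coefficient.\<close>

lemma is_lead_schur_combination:
  fixes a :: "nat list \<Rightarrow> int"
  assumes "finite S" "\<And>kap. kap \<in> S \<Longrightarrow> is_partition kap \<and> length kap \<le> n" "\<exists>kap\<in>S. a kap \<noteq> 0"
  obtains kap where "kap \<in> S" "a kap \<noteq> 0"
    "is_lead (\<Sum>kap\<in>S. of_int (a kap) * schur_at kap (map indet [0..<n]) :: (nat \<Rightarrow>\<^sub>0 nat) \<Rightarrow>\<^sub>0 'c::comm_ring_1)
      (exponents kap) (of_int (a kap))"
proof -
  let ?S = "{kap \<in> S. a kap \<noteq> 0}"
  let ?s = "\<lambda>kap. schur_at kap (map indet [0..<n]) :: (nat \<Rightarrow>\<^sub>0 nat) \<Rightarrow>\<^sub>0 'c"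
  define E where "E = Max (exponents ` ?S)"
  have fin: "finite (exponents ` ?S)" "exponents ` ?S \<noteq> {}" using assms by auto
  then obtain kap where kap: "kap \<in> S" "a kap \<noteq> 0" "E = exponents kap"
    unfolding E_def using Max_in by blast
  have lead: "is_lead (?s k) (exponents k) 1" if "k \<in> S" for k
    using assms(2)[OF that] by (intro is_lead_schur) (auto simp: is_partition_def)
  have le: "exponents k \<le> exponents kap" if "k \<in> S" "a k \<noteq> 0" for k
    unfolding kap(3)[symmetric] E_def using that fin(1) by (intro Max_ge) auto
  have coeff: "lookup (of_int (a k) * ?s k) t = of_int (a k) * lookup (?s k) t" for k t
    by (simp add: lookup_of_int_mult)
  have c: "lookup (of_int (a k) * ?s k) (exponents kap) = (if k = kap then of_int (a k) else 0)" if k: "k \<in> S" for k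
  proof (cases "k = kap \<or> a k = 0")
    case True
    then show ?thesis using lead[OF k] by (auto simp: coeff is_lead_def)
  next
    case False
    have "exponents k \<noteq> exponents kap"
    proof
      assume eq: "exponents k = exponents kap"
      have "part k i = part kap i" for i using eq lookup_exponents by metis
      then show False using is_partition_eqI[of k kap] assms(2) k kap(1) False by blast
    qed
    then have "exponents kap \<notin> keys (?s k)"
      using lead[OF k] le[OF k] False by (auto simp: is_lead_def)
    then show ?thesis using False by (simp add: coeff in_keys_iff)
  qed
  have "lookup (\<Sum>k\<in>S. of_int (a k) * ?s k) (exponents kap) = of_int (a kap)"
    unfolding lookup_sum using c kap(1) assms(1) by simp
  moreover have "t \<le> exponents kap" if t: "t \<in> keys (\<Sum>k\<in>S. of_int (a k) * ?s k)" for t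
  proof -
    obtain k where k: "k \<in> S" "lookup (of_int (a k) * ?s k) t \<noteq> 0"
      using t by (auto simp: in_keys_iff lookup_sum dest: sum.not_neutral_contains_not_neutral)
    then have "a k \<noteq> 0" "t \<in> keys (?s k)" by (auto simp: coeff in_keys_iff)
    then show ?thesis using lead[OF k(1)] le[OF k(1)] by (auto simp: is_lead_def)
  qed
  ultimately show ?thesis using that[OF kap(1,2)] by (auto simp: is_lead_def)
qed

subsection \<open>The Schur expansion\<close>

definition monomials :: "nat \<Rightarrow> nat \<Rightarrow> (nat \<Rightarrow>\<^sub>0 nat) set" where
  "monomials n d = {t. keys t \<subseteq> {..<n} \<and> (\<Sum>i<n. lookup t i) = d}"

lemma finite_monomials: "finite (monomials n d)"
proof (rule finite_imageD)
  have "lookup ` monomials n d \<subseteq> {f. \<forall>i. (i \<in> {..<n} \<longrightarrow> f i \<in> {..d}) \<and> (i \<notin> {..<n} \<longrightarrow> f i = 0)}"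
    by (auto simp: monomials_def in_keys_iff intro: member_le_sum)
  then show "finite (lookup ` monomials n d)"
    by (rule finite_subset) (rule finite_set_of_finite_funs; simp)
  show "inj_on lookup (monomials n d)"
    by (auto intro: inj_onI poly_mapping_eqI)
qed

lemma sum_monomials:
  assumes "\<And>c. c \<in> A \<Longrightarrow> e c \<in> monomials n d"
  shows "(\<Sum>c\<in>A. e c) \<in> monomials n (card A * d)"
proof -
  have "keys (\<Sum>c\<in>A. e c) \<subseteq> {..<n}"
    using keys_sum[of e A] assms by (fastforce simp: monomials_def)
  moreover have "(\<Sum>i<n. lookup (\<Sum>c\<in>A. e c) i) = (\<Sum>c\<in>A. \<Sum>i<n. lookup (e c) i)"
    unfolding lookup_sum by (rule sum.swap)
  moreover have "\<dots> = (\<Sum>c\<in>A. d)"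
    using assms by (intro sum.cong) (auto simp: monomials_def)
  ultimately show ?thesis by (simp add: monomials_def)
qed

lemma card_diagram: "card (diagram lam) = sum_list lam"
proof -
  have "card (diagram lam) = (\<Sum>i<length lam. card ((\<lambda>j. (j, i)) ` {..<part lam i}))"
    unfolding diagram_eq by (intro card_UN_disjoint) auto
  also have "\<dots> = (\<Sum>i<length lam. lam ! i)"
    by (intro sum.cong) (auto simp: card_image inj_on_def part_def)
  finally show ?thesis by (simp add: sum_list_sum_nth lessThan_atLeast0)
qed

lemma weight_monomials:
  assumes "T \<in> ssyt lam n"
  shows "weight lam T \<in> monomials n (sum_list lam)"
proof -
  have "single (T c) 1 \<in> monomials n 1" if "c \<in> diagram lam" for c
    using that assms by (auto simp: monomials_def ssyt_def lookup_single when_def)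
  then have "weight lam T \<in> monomials n (card (diagram lam) * 1)"
    unfolding weight_def by (rule sum_monomials)
  then show ?thesis by (simp add: card_diagram)
qed

lemma keys_sum_single_one:
  "keys (\<Sum>a\<in>A. single (e a) (1::int)) \<subseteq> e ` A"
  by (rule order_trans[OF keys_sum]) auto

lemma schur_poly_eq: "schur_poly n lam = (\<Sum>T\<in>ssyt lam n. single (weight lam T) 1)"
  unfolding schur_poly_def indet_eq_var[symmetric] by (rule schur_at_indet)

lemma keys_schur_poly: "keys (schur_poly n lam) \<subseteq> monomials n (sum_list lam)"
proof -
  have "keys (schur_poly n lam) \<subseteq> weight lam ` ssyt lam n"
    unfolding schur_poly_eq by (rule keys_sum_single_one)
  then show ?thesis using weight_monomials[of _ lam n] by blast
qed

lemma tab_monomial_eq: "tab_monomial nu T = single (weight nu T) 1"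
  unfolding tab_monomial_def var_def weight_def by (rule prod_single_one)

lemma keys_plethysm_poly: "keys (plethysm_poly n mu nu) \<subseteq> monomials n (sum_list mu * sum_list nu)"
proof -
  obtain ts where ts: "distinct ts" "set ts = ssyt nu n"
    "plethysm_poly n mu nu = schur_at mu (map (tab_monomial nu) ts)"
    by (rule plethysm_poly_obtain)
  define e where "e S = (\<Sum>c\<in>diagram mu. weight nu (ts ! S c))" for S
  have e: "e S \<in> monomials n (sum_list mu * sum_list nu)" if "S \<in> ssyt mu (length ts)" for S
  proof -
    have "weight nu (ts ! S c) \<in> monomials n (sum_list nu)" if c: "c \<in> diagram mu" for c
    proof (rule weight_monomials)
      have "S c < length ts" using c \<open>S \<in> ssyt mu (length ts)\<close> unfolding ssyt_def by blast
      then show "ts ! S c \<in> ssyt nu n" using nth_mem ts(2) by blast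
    qed
    then have "e S \<in> monomials n (card (diagram mu) * sum_list nu)"
      unfolding e_def by (rule sum_monomials)
    then show ?thesis by (simp only: card_diagram)
  qed
  have "plethysm_poly n mu nu = (\<Sum>S\<in>ssyt mu (length ts). single (e S) 1)"
    unfolding ts(3) schur_at_def length_map
  proof (intro sum.cong refl)
    fix S assume "S \<in> ssyt mu (length ts)"
    then have "(\<Prod>c\<in>diagram mu. map (tab_monomial nu) ts ! S c) = (\<Prod>c\<in>diagram mu. single (weight nu (ts ! S c)) 1)"
      by (intro prod.cong) (auto simp: ssyt_def tab_monomial_eq)
    also have "\<dots> = single (e S) 1" unfolding e_def by (rule prod_single_one)
    finally show "(\<Prod>c\<in>diagram mu. map (tab_monomial nu) ts ! S c) = single (e S) 1" .
  qed
  then have "keys (plethysm_poly n mu nu) \<subseteq> e ` ssyt mu (length ts)"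
    by (simp only:) (rule keys_sum_single_one)
  then show ?thesis using e by blast
qed

lemma length_le_sum_list:
  assumes "is_partition kap"
  shows "length kap \<le> sum_list kap"
  using assms by (induction kap) (auto simp: is_partition_def Suc_le_eq intro: add_le_mono[of 1, simplified])

lemma finite_partitions_of: "finite (partitions_of d)"
proof (rule finite_subset)
  show "partitions_of d \<subseteq> {xs. set xs \<subseteq> {..d} \<and> length xs \<le> d}"
    using length_le_sum_list member_le_sum_list by (fastforce simp: partitions_of_def)
  show "finite \<dots>" by (rule finite_lists_length_le) simp
qed

lemma partition_of_monomial:
  assumes "t \<in> monomials n d" and mono: "\<And>i j. i < j \<Longrightarrow> j < n \<Longrightarrow> lookup t j \<le> lookup t i"
  obtains kap where "kap \<in> partitions_of d" "exponents kap = t" "length kap \<le> n"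
proof -
  let ?xs = "map (lookup t) [0..<n]"
  \<comment> \<open>\<open>is_partition\<close> excludes zeros. As the exponents decrease weakly,
    cutting at the first zero removes only zeros.\<close>
  define kap where "kap = takeWhile (\<lambda>x. 0 < x) ?xs"
  have len: "length kap \<le> n"
    using length_takeWhile_le[of "\<lambda>x. 0 < x" ?xs] by (simp add: kap_def)
  have nth: "kap ! i = lookup t i" if "i < length kap" for i
    using that len takeWhile_nth[of i "\<lambda>x. 0 < x" ?xs] by (simp add: kap_def)
  have "part kap i = lookup t i" for i
  proof (cases "i < length kap")
    case False
    have "lookup t i = 0"
    proof (cases "i < n")
      case True
      then have l: "length kap < n" using False by simp
      then have "\<not> 0 < ?xs ! length kap"
        using nth_length_takeWhile[of "\<lambda>x. 0 < x" ?xs] by (simp add: kap_def)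
      then have "lookup t (length kap) = 0" using l by simp
      then show ?thesis using mono[of "length kap" i] True False by (cases "length kap = i") auto
    next
      case False
      then show ?thesis using assms(1) by (auto simp: monomials_def in_keys_iff)
    qed
    then show ?thesis using False by (simp add: part_def)
  qed (simp add: part_def nth)
  then have e: "exponents kap = t" by (intro poly_mapping_eqI) simp
  have "sum_list kap = (\<Sum>i<length kap. lookup t i)"
    by (simp add: sum_list_sum_nth lessThan_atLeast0 nth)
  also have "\<dots> = (\<Sum>i<n. lookup t i)"
  proof (rule sum.mono_neutral_left)
    show "\<forall>i\<in>{..<n} - {..<length kap}. lookup t i = 0"
      unfolding e[symmetric] by (simp add: part_def)
  qed (use len in auto)
  finally have "sum_list kap = d" using assms(1) by (simp add: monomials_def)
  moreover have "is_partition kap"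
    unfolding is_partition_def
  proof
    show "sorted_wrt (\<ge>) kap"
      using mono len by (simp add: sorted_wrt_iff_nth_less nth)
    show "\<forall>x\<in>set kap. 0 < x" by (auto simp: kap_def dest: set_takeWhileD)
  qed
  ultimately show ?thesis using that e len by (simp add: partitions_of_def)
qed

text \<open>Otherwise exchanging the exponents of \<open>i\<close> and \<open>j\<close> would give a
  larger monomial, which symmetry puts into \<open>keys f\<close>.\<close>

lemma symmetric_ipoly_max_monomial:
  assumes "symmetric_ipoly n f" "t \<in> keys f" "\<And>s. s \<in> keys f \<Longrightarrow> s \<le> t" "i < j" "j < n"
  shows "lookup t j \<le> lookup t i"
proof (rule ccontr)
  assume "\<not> lookup t j \<le> lookup t i"
  then have "t < swap_exponents i j t"
    unfolding less_poly_mapping.rep_eq less_fun_def lookup_swap_exponents using assms(4)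
    by (intro exI[of _ i]) (auto simp: transpose_def)
  moreover have "swap_exponents i j t \<in> keys f"
    using symmetric_ipoly_lookup[OF assms(1), of i j t] assms by (simp add: in_keys_iff)
  ultimately show False using assms(3) by fastforce
qed

lemma is_lead_schur_poly:
  assumes "is_partition lam" "length lam \<le> n"
  shows "is_lead (schur_poly n lam) (exponents lam) 1"
  using is_lead_schur[of lam n] assms unfolding schur_poly_def indet_eq_var[symmetric] is_partition_def by blast

text \<open>Leading term elimination: the exponent of the largest monomial is a partition, and
  subtracting the matching multiple of its Schur polynomial lowers the leading monomial.\<close>

lemma schur_expansion_exists:
  assumes "symmetric_ipoly n f" "keys f \<subseteq> monomials n d"
  shows "\<exists>a. (\<forall>kap. kap \<notin> partitions_of d \<longrightarrow> a kap = 0) \<and>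
    f = (\<Sum>kap\<in>partitions_of d. of_int (a kap) * schur_poly n kap)"
  using assms
proof (induction "card {s \<in> monomials n d. \<exists>t\<in>keys f. s \<le> t}" arbitrary: f rule: less_induct)
  case less
  show ?case
  proof (cases "f = 0")
    case True
    then show ?thesis by (intro exI[of _ "\<lambda>_. 0"]) simp
  next
    case False
    then have ne: "keys f \<noteq> {}" by (simp add: poly_mapping_eq_iff fun_eq_iff in_keys_iff set_eq_iff)
    define t where "t = Max (keys f)"
    have max: "s \<le> t" if "s \<in> keys f" for s
      using that by (simp add: t_def)
    have t: "t \<in> keys f" using ne by (simp add: t_def)
    have "lookup t j \<le> lookup t i" if "i < j" "j < n" for i j
      using symmetric_ipoly_max_monomial[OF less.prems(1) t max that] .
    then obtain kap where kap: "kap \<in> partitions_of d" "exponents kap = t" "length kap \<le> n"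
      using partition_of_monomial[of t n d] t less.prems(2) by blast
    then have kap': "is_partition kap" "sum_list kap = d" by (auto simp: partitions_of_def)
    define c where "c = lookup f t"
    define f' where "f' = f - of_int c * schur_poly n kap"
    have lead: "is_lead (schur_poly n kap) t 1"
      using is_lead_schur_poly[OF kap'(1) kap(3)] kap(2) by simp
    have look: "lookup f' s = lookup f s - c * lookup (schur_poly n kap) s" for s
      by (simp add: f'_def lookup_minus lookup_of_int_mult)
    have keys_f': "s \<in> keys f \<or> s \<in> keys (schur_poly n kap)" if "s \<in> keys f'" for s
      using that by (auto simp: in_keys_iff look)
    have less_t: "s < t" if "s \<in> keys f'" for s
    proof -
      have "s \<noteq> t" using that lead by (auto simp: in_keys_iff look is_lead_def c_def)
      moreover have "s \<le> t" using keys_f'[OF that] max lead by (auto simp: is_lead_def)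
      ultimately show ?thesis by simp
    qed
    have mon: "keys f' \<subseteq> monomials n d"
      using keys_f' less.prems(2) keys_schur_poly[of n kap] kap'(2) by blast
    have sym: "symmetric_ipoly n f'"
      unfolding symmetric_ipoly_def
    proof (intro allI impI)
      fix i j assume ij: "i < n" "j < n"
      interpret comm_ring_hom "eval_ipoly (\<lambda>k. var (transpose i j k))" by (rule comm_ring_hom_eval_ipoly)
      have "symmetric_ipoly n (schur_poly n kap)"
        using kap'(1) by (intro symmetric_schur_poly) (simp add: is_partition_def)
      then show "eval_ipoly (\<lambda>k. var (transpose i j k)) f' = f'"
        using less.prems(1) ij by (simp add: f'_def symmetric_ipoly_def hom_minus hom_mult hom_of_int)
    qed
    \<comment> \<open>The old leading monomial \<open>t\<close> leaves the finite set whose size is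
      the induction measure, since every monomial of \<open>f'\<close> is smaller.\<close>
    have "{s \<in> monomials n d. \<exists>t\<in>keys f'. s \<le> t} \<subset> {s \<in> monomials n d. \<exists>t\<in>keys f. s \<le> t}"
    proof
      show "{s \<in> monomials n d. \<exists>t\<in>keys f'. s \<le> t} \<subseteq> {s \<in> monomials n d. \<exists>t\<in>keys f. s \<le> t}"
      proof clarify
        fix s u assume "u \<in> keys f'" "s \<le> u"
        then have "s \<le> t" using less_t[of u] by simp
        then show "\<exists>t\<in>keys f. s \<le> t" using t by blast
      qed
      have "t \<in> {s \<in> monomials n d. \<exists>t\<in>keys f. s \<le> t}" using t less.prems(2) by auto
      moreover have "t \<notin> {s \<in> monomials n d. \<exists>t\<in>keys f'. s \<le> t}" using less_t by force
      ultimately show "{s \<in> monomials n d. \<exists>t\<in>keys f'. s \<le> t} \<noteq> {s \<in> monomials n d. \<exists>t\<in>keys f. s \<le> t}"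
        by blast
    qed
    then have "card {s \<in> monomials n d. \<exists>t\<in>keys f'. s \<le> t} < card {s \<in> monomials n d. \<exists>t\<in>keys f. s \<le> t}"
      by (rule psubset_card_mono[rotated]) (simp add: finite_monomials)
    from less.hyps[OF this sym mon] obtain a where a: "\<And>k. k \<notin> partitions_of d \<Longrightarrow> a k = 0"
      "f' = (\<Sum>k\<in>partitions_of d. of_int (a k) * schur_poly n k)" by blast
    define b where "b k = a k + (if k = kap then c else 0)" for k
    have "(\<Sum>k\<in>partitions_of d. of_int (b k) * schur_poly n k) =
        f' + (\<Sum>k\<in>partitions_of d. if k = kap then of_int c * schur_poly n kap else 0)"
      unfolding a(2) sum.distrib[symmetric] by (intro sum.cong) (auto simp: b_def distrib_right)
    also have "\<dots> = f" using kap(1) finite_partitions_of by (simp add: f'_def)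
    finally show ?thesis using a(1) kap(1) by (intro exI[of _ b]) (auto simp: b_def)
  qed
qed

lemma partitions_of_length: "kap \<in> partitions_of d \<Longrightarrow> is_partition kap \<and> length kap \<le> d"
  using length_le_sum_list by (auto simp: partitions_of_def)

text \<open>Partitions of \<open>d\<close> have at most \<open>d\<close> parts, so in
  \<open>d\<close> variables every leading monomial is present and a nontrivial combination has a
  nonzero one.\<close>

lemma schur_poly_independent:
  assumes "(\<Sum>kap\<in>partitions_of d. of_int (a kap) * schur_poly d kap) = 0" "kap \<in> partitions_of d"
  shows "a kap = 0"
proof (rule ccontr)
  assume "a kap \<noteq> 0"
  then have "\<exists>kap\<in>partitions_of d. a kap \<noteq> 0" using assms(2) by blast
  from is_lead_schur_combination[OF finite_partitions_of partitions_of_length this] obtain kap' where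
    "a kap' \<noteq> 0" "is_lead (\<Sum>kap\<in>partitions_of d. of_int (a kap) * schur_poly d kap) (exponents kap') (of_int (a kap'))"
    unfolding schur_poly_def indet_eq_var[symmetric] by blast
  then show False unfolding assms(1) by (simp add: is_lead_def)
qed

text \<open>Existence and uniqueness of the expansion show that the \<open>THE\<close> in
  \<open>plethysm_coeff\<close> denotes it.\<close>

lemma plethysm_coeff_expansion:
  assumes "is_partition mu" "is_partition nu"
  defines "d \<equiv> sum_list mu * sum_list nu"
  shows "kap \<notin> partitions_of d \<Longrightarrow> plethysm_coeff kap mu nu = 0"
    and "plethysm_poly d mu nu = (\<Sum>kap\<in>partitions_of d. of_int (plethysm_coeff kap mu nu) * schur_poly d kap)"
proof -
  let ?P = "\<lambda>a. (\<forall>kap. kap \<notin> partitions_of d \<longrightarrow> a kap = 0) \<and>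
    plethysm_poly d mu nu = (\<Sum>kap\<in>partitions_of d. of_int (a kap) * schur_poly d kap)"
  have "\<exists>a. ?P a"
    unfolding d_def using assms
    by (intro schur_expansion_exists symmetric_plethysm_poly keys_plethysm_poly) (auto simp: is_partition_def)
  then obtain a where a: "?P a" by blast
  have "b = a" if b: "?P b" for b
  proof
    fix k
    have "(\<Sum>kap\<in>partitions_of d. of_int (b kap - a kap) * schur_poly d kap) = 0"
      using a b by (simp add: left_diff_distrib sum_subtractf)
    then have "b k - a k = 0" if "k \<in> partitions_of d"
      using schur_poly_independent[of "\<lambda>kap. b kap - a kap"] that by blast
    then show "b k = a k" using a b by (cases "k \<in> partitions_of d") auto
  qed
  then have "?P (THE a. ?P a)" using a by (intro theI[of ?P a])
  moreover have "plethysm_coeff kap mu nu = (THE a. ?P a) kap" for kap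
    by (simp add: plethysm_coeff_def d_def Let_def)
  ultimately show "kap \<notin> partitions_of d \<Longrightarrow> plethysm_coeff kap mu nu = 0"
    and "plethysm_poly d mu nu = (\<Sum>kap\<in>partitions_of d. of_int (plethysm_coeff kap mu nu) * schur_poly d kap)"
    by simp_all
qed

section \<open>The ideal of large exponents and the contradiction\<close>

text \<open>The monomial ideal generated by the \<open>N\<close>-th powers of the variables with
  index in \<open>Z\<close>.\<close>

definition large_exponent_ideal :: "nat set \<Rightarrow> nat \<Rightarrow> ((nat \<Rightarrow>\<^sub>0 nat) \<Rightarrow>\<^sub>0 'c::comm_ring_1) set" where
  "large_exponent_ideal Z N = {f. \<forall>t\<in>keys f. \<exists>i\<in>Z. N \<le> lookup t i}"

lemma ring_ideal_large_exponent:
  "ring_ideal (large_exponent_ideal Z N :: ((nat \<Rightarrow>\<^sub>0 nat) \<Rightarrow>\<^sub>0 'c::comm_ring_1) set)"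
proof
  fix f g :: "(nat \<Rightarrow>\<^sub>0 nat) \<Rightarrow>\<^sub>0 'c"
  assume f: "f \<in> large_exponent_ideal Z N"
  show "f + g \<in> large_exponent_ideal Z N" if "g \<in> large_exponent_ideal Z N"
    using f that keys_add[of f g] by (auto simp: large_exponent_ideal_def)
  show "g * f \<in> large_exponent_ideal Z N"
    unfolding large_exponent_ideal_def
  proof safe
    fix t assume "t \<in> keys (g * f)"
    then obtain x y where xy: "y \<in> keys f" "t = x + y" using keys_mult[of g f] by blast
    then obtain i where "i \<in> Z" "N \<le> lookup y i" using f by (auto simp: large_exponent_ideal_def)
    then show "\<exists>i\<in>Z. N \<le> lookup t i" using xy(2) by (intro bexI[of _ i]) (simp_all add: lookup_add)
  qed
qed (simp add: large_exponent_ideal_def)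

theorem mainTheorem5:
  fixes mu nu lam :: "nat list"
  assumes "is_partition mu" and "is_partition nu" and "is_partition lam"
    and "mu \<noteq> []"
    and "plethysm_coeff lam mu nu \<noteq> 0"
  shows "diagram nu \<subseteq> diagram lam"
proof (rule ccontr)
  assume "\<not> diagram nu \<subseteq> diagram lam"
  then obtain j i where ji: "(j, i) \<in> diagram nu" "(j, i) \<notin> diagram lam" by auto
  define d where "d = sum_list mu * sum_list nu"
  define a where "a kap = plethysm_coeff kap mu nu" for kap
  define S where "S = {kap \<in> partitions_of d. (j, i) \<notin> diagram kap}"
  \<comment> \<open>Complex coefficients provide the roots of unity and the inverses of positive
    integers behind \<open>plethysm_mem\<close>. The letters \<open>xs\<close> come last in
    \<open>zs @ xs\<close>, where branching strips them off.\<close>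
  define zs where "zs = map (indet :: nat \<Rightarrow> (nat \<Rightarrow>\<^sub>0 nat) \<Rightarrow>\<^sub>0 complex) [i..<d]"
  define xs where "xs = map (indet :: nat \<Rightarrow> (nat \<Rightarrow>\<^sub>0 nat) \<Rightarrow>\<^sub>0 complex) [0..<i]"
  define vs where "vs = map (indet :: nat \<Rightarrow> (nat \<Rightarrow>\<^sub>0 nat) \<Rightarrow>\<^sub>0 complex) [0..<d]"
  have "i < length nu" using ji(1) by (auto simp: diagram_def part_def split: if_splits)
  moreover have "sum_list mu > 0" using assms(1,4) by (cases mu) (auto simp: is_partition_def)
  \<comment> \<open>The strict inequality makes \<open>zs\<close> nonempty, as
    \<open>complete_gf_vandermonde_mem\<close> requires.\<close>
  ultimately have id: "i < d"
    using length_le_sum_list[OF assms(2)] by (auto simp: d_def intro: order_less_le_trans)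
  then have "[0..<d] = [0..<i] @ [i..<d]" using upt_add_eq_append[of 0 i "d - i"] by simp
  then have vs: "mset vs = mset (zs @ xs)" by (simp add: vs_def zs_def xs_def)
  \<comment> \<open>With \<open>d - i\<close> variables in \<open>zs\<close>, this bound is small
    enough for every degree above \<open>j\<close> in \<open>complete_gf_vandermonde_mem\<close>,
    yet exceeds \<open>j\<close> plus any exponent of the leading monomial of
    \<open>vandermonde zs\<close>, which is at most \<open>d - i - 1\<close>.\<close>
  define N where "N = j + (d - i)"
  define M where "M = (large_exponent_ideal {i..<d} N :: ((nat \<Rightarrow>\<^sub>0 nat) \<Rightarrow>\<^sub>0 complex) set)"
  define K where "K = {f. f * vandermonde zs \<in> M}"
  interpret M: ring_ideal M unfolding M_def by (rule ring_ideal_large_exponent)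
  have K: "ring_ideal K" unfolding K_def by (rule M.colon_ideal)
  interpret K: ring_ideal K by (rule K)
  have h: "comm_ring_hom (single 0 :: complex \<Rightarrow> (nat \<Rightarrow>\<^sub>0 nat) \<Rightarrow>\<^sub>0 complex)"
    by unfold_locales (simp_all add: single_add mult_single)
  have mem: "complete_gf zs $ q \<in> K" if "Suc j \<le> q" for q
    unfolding K_def mem_Collect_eq
  proof (rule M.complete_gf_vandermonde_mem)
    fix z assume "z \<in> set zs"
    then obtain b where b: "b \<in> {i..<d}" "z = indet b" by (auto simp: zs_def)
    have "z ^ N = single (single b N) 1" unfolding b(2) by (rule indet_power)
    then show "z ^ N \<in> M" using b(1) by (auto simp: M_def large_exponent_ideal_def intro: bexI[of _ b])
  qed (use id that in \<open>auto simp: zs_def N_def\<close>)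
  obtain ts where ts: "distinct ts" "set ts = ssyt nu d"
    "plethysm_poly d mu nu = schur_at mu (map (tab_monomial nu) ts)"
    by (rule plethysm_poly_obtain)
  define \<phi> where "\<phi> = eval_ipoly (indet :: nat \<Rightarrow> (nat \<Rightarrow>\<^sub>0 nat) \<Rightarrow>\<^sub>0 complex)"
  have hom: "comm_ring_hom \<phi>" unfolding \<phi>_def by (rule comm_ring_hom_eval_ipoly)
  interpret \<phi>: comm_ring_hom \<phi> by (rule hom)
  have "\<phi> (plethysm_poly d mu nu) = schur_at mu (map (\<lambda>T. \<phi> (tab_monomial nu T)) ts)"
    by (simp add: ts(3) \<phi>.hom_schur_at comp_def)
  also have "\<dots> \<in> K"
  proof (rule plethysm_mem[OF K h _ _ _ mem vs _ assms(1,4)])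
    show "Suc j \<le> part nu (length xs)" using ji(1) by (simp add: diagram_def xs_def)
    show "power_sum k (map (\<lambda>T. \<phi> (tab_monomial nu T)) ts) = schur_at nu (map (\<lambda>v. v ^ k) vs)" for k
      unfolding vs_def using power_sum_tab_monomial[OF hom ts(1,2), of indet k]
      by (simp add: \<phi>_def eval_ipoly_var comp_def)
  qed (use assms(2) in \<open>auto simp: is_partition_def\<close>)
  finally have PK: "\<phi> (plethysm_poly d mu nu) \<in> K" .
  have \<phi>_schur: "\<phi> (schur_poly d kap) = schur_at kap vs" for kap
    by (simp add: \<phi>_def vs_def eval_schur_poly)
  \<comment> \<open>Shapes through the cell \<open>(j, i)\<close> have more than \<open>j\<close>
    cells in row \<open>i = length xs\<close>, so their Schur polynomials lie in
    \<open>K\<close>.\<close>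
  have "of_int (a kap) * schur_at kap vs \<in> K" if "kap \<in> partitions_of d - S" for kap
  proof (rule K.mult_mem)
    have k: "sorted_wrt (\<ge>) kap" "Suc j \<le> part kap (length xs)"
      using that by (auto simp: S_def partitions_of_def is_partition_def diagram_def xs_def)
    have "schur_at kap (zs @ xs) \<in> K"
      by (rule K.schur_at_mem_append[OF k _ mem]) simp_all
    then show "schur_at kap vs \<in> K" using schur_at_mset[OF k(1) vs] by simp
  qed
  then have rest: "(\<Sum>kap\<in>partitions_of d - S. of_int (a kap) * schur_at kap vs) \<in> K"
    by (rule K.sum_mem)
  have "\<phi> (plethysm_poly d mu nu) = (\<Sum>kap\<in>partitions_of d. of_int (a kap) * schur_at kap vs)"
    unfolding plethysm_coeff_expansion(2)[OF assms(1,2), folded d_def] a_def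
    by (simp add: \<phi>.hom_sum \<phi>.hom_mult \<phi>.hom_of_int \<phi>_schur)
  also have "\<dots> = (\<Sum>kap\<in>partitions_of d - S. of_int (a kap) * schur_at kap vs) +
      (\<Sum>kap\<in>S. of_int (a kap) * schur_at kap vs)"
    by (rule sum.subset_diff) (auto simp: S_def finite_partitions_of)
  finally have SK: "(\<Sum>kap\<in>S. of_int (a kap) * schur_at kap vs) \<in> K"
    using K.diff_mem[OF PK rest] by simp
  have "lam \<in> partitions_of d"
    using plethysm_coeff_expansion(1)[OF assms(1,2)] assms(5) by (auto simp: d_def)
  \<comment> \<open>\<open>lam\<close> itself witnesses that the combination over \<open>S\<close>
    is nontrivial.\<close>
  then have "\<exists>kap\<in>S. a kap \<noteq> 0" using assms(5) ji(2) by (auto simp: S_def a_def)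
  moreover have "finite S" by (simp add: S_def finite_partitions_of)
  moreover have "is_partition kap \<and> length kap \<le> d" if "kap \<in> S" for kap
    using that partitions_of_length[of kap d] by (simp add: S_def)
  ultimately obtain kap where kap: "kap \<in> S" "a kap \<noteq> 0"
    "is_lead (\<Sum>kap\<in>S. of_int (a kap) * schur_at kap vs) (exponents kap) (of_int (a kap))"
    unfolding vs_def using is_lead_schur_combination by blast
  obtain e where e: "is_lead (vandermonde zs) e 1" "\<And>b. lookup e b < max 1 (length [i..<d])"
    unfolding zs_def using is_lead_vandermonde[of "[i..<d]"] by auto
  \<comment> \<open>The coefficient of this leading monomial is \<open>of_int (a kap)\<close>,
    nonzero in characteristic 0. By \<open>SK\<close> some variable of \<open>zs\<close> has
    exponent at least \<open>N\<close> in it, but a row \<open>b >= i\<close> of a shape avoiding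
    \<open>(j, i)\<close> has at most \<open>j\<close> cells.\<close>
  have "exponents kap + e \<in> keys ((\<Sum>kap\<in>S. of_int (a kap) * schur_at kap vs) * vandermonde zs)"
    using is_lead_mult[OF kap(3) e(1)] kap(2) by (simp add: is_lead_def in_keys_iff)
  then have "\<exists>b\<in>{i..<d}. N \<le> lookup (exponents kap + e) b"
    using SK unfolding K_def M_def large_exponent_ideal_def by blast
  then obtain b where b: "i \<le> b" "b < d" "N \<le> part kap b + lookup e b"
    by (auto simp: lookup_add)
  have "part kap b \<le> part kap i"
    using kap(1) b(1) by (intro part_mono) (auto simp: S_def partitions_of_def is_partition_def)
  also have "\<dots> \<le> j" using kap(1) by (auto simp: S_def diagram_def)
  finally show False using b(3) e(2)[of b] id by (simp add: N_def)
qed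

end
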